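(* Let $n\in\mathbb{N}$ with $n\ge2$ and let $V(x)=|x|^2/2+(n/2)\log(2\pi)$, so that $e^{-V}$ is the standard Gaussian density in $\mathbb{R}^n$. Then for every $C>0$ there exists a bounded, continuous function $p:\mathbb{R}^n\to\mathbb{R}$ such that $\|p\|_{L^\infty(\mathbb{R}^n)}\le1$, $e^{-V(x)-p(x)}\,dx\in\mathcal{P}(\mathbb{R}^n)$, and the optimal transport $T=\nabla\phi$ that takes $e^{-V(x)}\,dx$ to $e^{-V(x)-p(x)}\,dx$ satisfies $$\|D^2\phi-\mathrm{Id}\|_{L^\infty(\mathbb{R}^n)}>C\,\|p\|_{L^\infty(\mathbb{R}^n)}.$$
   Context: $\mathcal{P}(\mathbb{R}^n)$ is the set of Borel probability measures on $\mathbb{R}^n$. For $\mu,\nu\in\mathcal{P}(\mathbb{R}^n)$ with finite second moments and $\mu$ absolutely continuous, the optimal transport taking $\mu$ to $\nu$ is the $\mu$-a.e. unique minimizer of $\int|x-T(x)|^2\,d\mu(x)$ among Borel maps $T$ with $T_\#\mu=\nu$; it is the gradient $T=\nabla\phi$ of a convex function $\phi:\mathbb{R}^n\to\mathbb{R}$. $D^2\phi$ is the distributional Hessian, and the left-hand side of the inequality is interpreted as $+\infty$ when $D^2\phi$ is not an $L^\infty$ function. *)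

theory Defs
  imports "HOL-Probability.Probability"
begin

definition gauss_potential :: "real ^ 'n \<Rightarrow> real" where
  "gauss_potential x = (norm x)\<^sup>2 / 2 + real CARD('n) / 2 * ln (2 * pi)"

text \<open>The measure $e^{-W(x)}\,dx$.\<close>

definition exp_measure :: "(real ^ 'n \<Rightarrow> real) \<Rightarrow> (real ^ 'n) measure" where
  "exp_measure W = density lborel (\<lambda>x. ennreal (exp (- W x)))"

definition transport_map :: "(real ^ 'n) measure \<Rightarrow> (real ^ 'n) measure \<Rightarrow> (real ^ 'n \<Rightarrow> real ^ 'n) \<Rightarrow> bool" where
  "transport_map \<mu> \<nu> T \<longleftrightarrow> T \<in> borel_measurable borel \<and> distr \<mu> borel T = \<nu>"

definition transport_cost :: "(real ^ 'n) measure \<Rightarrow> (real ^ 'n \<Rightarrow> real ^ 'n) \<Rightarrow> ennreal" where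
  "transport_cost \<mu> T = (\<integral>\<^sup>+ x. ennreal ((norm (x - T x))\<^sup>2) \<partial>\<mu>)"

definition optimal_transport :: "(real ^ 'n) measure \<Rightarrow> (real ^ 'n) measure \<Rightarrow> (real ^ 'n \<Rightarrow> real ^ 'n) \<Rightarrow> bool" where
  "optimal_transport \<mu> \<nu> T \<longleftrightarrow> transport_map \<mu> \<nu> T \<and>
     (\<forall>S. transport_map \<mu> \<nu> S \<longrightarrow> transport_cost \<mu> T \<le> transport_cost \<mu> S)"

text \<open>\<open>T = \<nabla>\<phi>\<close> for a finite convex function \<open>\<phi>\<close>. Such a \<open>\<phi>\<close> need only be differentiable
  almost everywhere, so the equality is required \<open>\<mu>\<close>-almost everywhere.\<close>

definition convex_potential :: "(real ^ 'n) measure \<Rightarrow> (real ^ 'n \<Rightarrow> real ^ 'n) \<Rightarrow> (real ^ 'n \<Rightarrow> real) \<Rightarrow> bool" where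
  "convex_potential \<mu> T \<phi> \<longleftrightarrow> convex_on UNIV \<phi> \<and> (AE x in \<mu>. GDERIV \<phi> x :> T x)"

definition linf_norm :: "(real ^ 'n \<Rightarrow> real) \<Rightarrow> ereal" where
  "linf_norm f = esssup lborel (\<lambda>x. ereal \<bar>f x\<bar>)"

definition partial_deriv :: "'n \<Rightarrow> (real ^ 'n \<Rightarrow> real) \<Rightarrow> real ^ 'n \<Rightarrow> real" where
  "partial_deriv i f x = frechet_derivative f (at x) (axis i 1)"

primrec Ck :: "nat \<Rightarrow> (real ^ 'n \<Rightarrow> real) \<Rightarrow> bool" where
  "Ck 0 f \<longleftrightarrow> continuous_on UNIV f"
| "Ck (Suc k) f \<longleftrightarrow> f differentiable_on UNIV \<and> (\<forall>i. Ck k (partial_deriv i f))"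

definition test_function :: "(real ^ 'n \<Rightarrow> real) \<Rightarrow> bool" where
  "test_function \<psi> \<longleftrightarrow> (\<forall>k. Ck k \<psi>) \<and> compact (closure {x. \<psi> x \<noteq> 0})"

text \<open>The distributional Hessian of (locally integrable) \<open>\<phi>\<close> is the locally integrable function \<open>H\<close>.\<close>

definition has_distr_hessian :: "(real ^ 'n \<Rightarrow> real) \<Rightarrow> (real ^ 'n \<Rightarrow> real ^ 'n ^ 'n) \<Rightarrow> bool" where
  "has_distr_hessian \<phi> H \<longleftrightarrow>
     H \<in> borel_measurable borel \<and>
     (\<forall>K. compact K \<longrightarrow> set_integrable lborel K H) \<and>
     (\<forall>i j \<psi>. test_function \<psi> \<longrightarrow>
        (LINT x|lborel. \<phi> x * partial_deriv i (partial_deriv j \<psi>) x) =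
        (LINT x|lborel. H x $ i $ j * \<psi> x))"

text \<open>\<open>\<parallel>D\<^sup>2\<phi> - Id\<parallel>\<close> in \<open>L\<^sup>\<infinity>\<close>, with the operator norm on matrices. The representative \<open>H\<close> of
  \<open>D\<^sup>2\<phi>\<close> is unique almost everywhere, so the infimum is over at most one value. It is \<open>\<infinity>\<close> if
  \<open>D\<^sup>2\<phi>\<close> is not a function (empty infimum) or is an essentially unbounded one.\<close>

definition hessian_minus_id_linf_norm :: "(real ^ 'n \<Rightarrow> real) \<Rightarrow> ereal" where
  "hessian_minus_id_linf_norm \<phi> =
     (INF H \<in> Collect (has_distr_hessian \<phi>). linf_norm (\<lambda>x. onorm ((*v) (H x - mat 1))))"

end

theory Submission
  imports Defs
begin

text \<open>
  Near the identity the Monge-Ampere equation linearises to an equation for the Laplacian, and a bound on the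
  Laplacian of a function does not bound its Hessian in $L^\infty$. The proof prescribes the transport map
  instead of the target. For a small function \<open>u\<close> on \<open>\<real>\<^sup>n\<close> the map \<open>T x = x + \<nabla>u x\<close> carries \<open>e\<^sup>-\<^sup>V dx\<close> to
  \<open>e\<^sup>-\<^sup>V\<^sup>-\<^sup>p dx\<close> with
    \<open>p (T x) = ln (det (I + D\<^sup>2u x)) - x \<bullet> \<nabla>u x - |\<nabla>u x|\<^sup>2 / 2\<close>,
  which is \<open>\<Delta>u x - x \<bullet> \<nabla>u x\<close> up to terms of second order. So what is needed is a function with bounded
  Laplacian and radial derivative, whose Hessian is as large as desired. In two of the coordinates such a function is
  \<open>X Y (ln (1 + s) - ln (d + s))\<close> with \<open>s = X\<^sup>2 + Y\<^sup>2\<close>: its mixed derivative at the origin is \<open>M = - ln d\<close>,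
  while the Laplacian and the radial derivative are bounded by \<open>8\<close> and \<open>2\<close> for all \<open>d\<close> between \<open>0\<close> and \<open>1\<close>
  (\<open>U_bounds\<close>). Multiplied by a number \<open>e\<close> that is small compared to \<open>1 / M\<^sup>2\<close> it gives \<open>|p| \<le> 21 e\<close>
  (\<open>pert_bound\<close>), whereas \<open>D\<^sup>2\<phi> - I\<close> has an entry \<open>e M\<close> at the origin. Taking \<open>M > 42 C\<close> proves the
  claim.

  It remains to see that this \<open>T\<close> is the optimal transport, and that the conclusion holds for every
  optimal map and every convex potential of it. Optimality and uniqueness follow from a pointwise lower
  bound of the cost \<open>|x - y|\<^sup>2\<close> by a function of \<open>x\<close> plus a function of \<open>y\<close> plus a multiple of \<open>|x - T\<^sup>-\<^sup>1 y|\<^sup>2\<close>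
  (\<open>cost_lower_bound\<close>), which is the strict convexity of \<open>|x|\<^sup>2 / 2 + u\<close> in disguise. A convex potential
  whose gradient is \<open>T\<close> almost everywhere is differentiable everywhere with gradient \<open>T\<close>, because \<open>T\<close> is
  continuous (\<open>convex_gradient_everywhere\<close>). Finally a weak Hessian that is too small is excluded by
  testing it against one smooth bump near the origin, where the classical Hessian of the potential is large
  (\<open>hessian_minus_id_linf_norm_ge\<close>). The formula for \<open>p\<close> is the change of variables theorem
  (\<open>distr_exp_measure\<close>).
\<close>

section \<open>Change of variables for an arbitrary finite index type\<close>

text \<open>
  A copy of a finite index type that carries a well-order. The change of variables theorem for
  \<open>real^'m\<close> speaks of well-ordered index types \<open>'m\<close>; through this copy it reaches every finite index
  type, because neither Lebesgue measure nor determinants depend on the names of the coordinates.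
\<close>

typedef 'n ordered_index = "UNIV :: 'n set"
  morphisms index_of Index ..

lemma bij_index_of: "bij (index_of :: 'n ordered_index \<Rightarrow> 'n)"
  by (metis UNIV_I Index_inverse index_of_inverse bijI' )

instance ordered_index :: (finite) finite
proof
  have "inj (index_of :: 'a ordered_index \<Rightarrow> 'a)"
    using bij_index_of bij_is_inj by blast
  then show "finite (UNIV :: 'a ordered_index set)"
    by (rule finite_imageD[rotated]) (rule finite)
qed

definition index_rank :: "'n::finite \<Rightarrow> nat" where
  "index_rank = (SOME f. inj f)"

lemma inj_index_rank: "inj (index_rank :: 'n::finite \<Rightarrow> nat)"
proof -
  have "\<exists>f :: 'n \<Rightarrow> nat. inj f"
    using finite_imp_inj_to_nat_seg[OF finite[of "UNIV :: 'n set"]] by auto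
  then show ?thesis
    unfolding index_rank_def by (rule someI_ex)
qed

instantiation ordered_index :: (finite) wellorder
begin

definition less_eq_ordered_index :: "'a ordered_index \<Rightarrow> 'a ordered_index \<Rightarrow> bool" where
  "less_eq_ordered_index x y \<longleftrightarrow> index_rank (index_of x) \<le> index_rank (index_of y)"

definition less_ordered_index :: "'a ordered_index \<Rightarrow> 'a ordered_index \<Rightarrow> bool" where
  "less_ordered_index x y \<longleftrightarrow> index_rank (index_of x) < index_rank (index_of y)"

instance
proof
  fix P :: "'a ordered_index \<Rightarrow> bool" and a
  assume "\<And>x. (\<And>y. y < x \<Longrightarrow> P y) \<Longrightarrow> P x"
  then show "P a"
    unfolding less_ordered_index_def
    by (induction a rule: measure_induct_rule[of "\<lambda>x. index_rank (index_of x)"]) blast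
next
  fix x y :: "'a ordered_index"
  assume "x \<le> y" "y \<le> x"
  then show "x = y"
    by (metis le_antisym less_eq_ordered_index_def inj_index_rank injD index_of_inject)
qed (auto simp: less_eq_ordered_index_def less_ordered_index_def)

end

text \<open>
  Conjugation by \<open>\<sigma>\<close> is a sign-preserving bijection between the permutations of the two index types, so
  the Leibniz sums agree term by term.
\<close>

lemma det_reindex:
  fixes A :: "real^'n::finite^'n" and \<sigma> :: "'m::finite \<Rightarrow> 'n"
  assumes "bij \<sigma>"
  shows "det (\<chi> i j. A $ \<sigma> i $ \<sigma> j) = det A"
proof -
  let ?m = "map_permutation (UNIV :: 'm set) \<sigma>"
  have inj: "inj_on \<sigma> UNIV" and surj: "\<sigma> ` UNIV = UNIV"
    using assms by (auto simp: bij_def)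
  have m_apply: "?m p (\<sigma> i) = \<sigma> (p i)" if "p permutes UNIV" for p :: "'m \<Rightarrow> 'm" and i
    using inj surj by (simp add: map_permutation_def restrict_id_def)
  have bij: "bij_betw ?m {p. p permutes UNIV} {p. p permutes UNIV}"
  proof (rule bij_betw_byWitness[where f' = "map_permutation UNIV (inv \<sigma>)"])
    show "\<forall>p\<in>{p. p permutes UNIV}. map_permutation UNIV (inv \<sigma>) (?m p) = p"
      using assms by (auto intro!: map_permutation_compose_inv[of \<sigma> UNIV UNIV] simp: bij_is_inj)
    show "\<forall>q\<in>{q. q permutes UNIV}. ?m (map_permutation UNIV (inv \<sigma>) q) = q"
      using assms bij_imp_bij_inv[OF assms]
      by (auto intro!: map_permutation_compose_inv[of "inv \<sigma>" UNIV UNIV] simp: bij_is_surj surj_f_inv_f)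
  qed (use assms bij_imp_bij_inv[OF assms] in \<open>auto intro: map_permutation_permutes\<close>)
  have "det A = (\<Sum>p\<in>{p. p permutes UNIV}. of_int (sign (?m p)) * (\<Prod>i\<in>UNIV. A $ i $ ?m p i))"
    unfolding det_def by (rule sum.reindex_bij_betw[OF bij, symmetric])
  also have "\<dots> = (\<Sum>p\<in>{p. p permutes UNIV}. of_int (sign p) * (\<Prod>i\<in>UNIV. A $ \<sigma> i $ \<sigma> (p i)))"
  proof (intro sum.cong refl)
    fix p :: "'m \<Rightarrow> 'm" assume p: "p \<in> {p. p permutes UNIV}"
    have "sign (?m p) = sign p"
      using p inj by (intro sign_map_permutation) auto
    moreover have "(\<Prod>i\<in>UNIV. A $ i $ ?m p i) = (\<Prod>i\<in>UNIV. A $ \<sigma> i $ ?m p (\<sigma> i))"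
      using prod.reindex_bij_betw[OF assms, of "\<lambda>i. A $ i $ ?m p i"] by simp
    ultimately show "of_int (sign (?m p)) * (\<Prod>i\<in>UNIV. A $ i $ ?m p i) =
        of_int (sign p) * (\<Prod>i\<in>UNIV. A $ \<sigma> i $ \<sigma> (p i))"
      using p by (simp add: m_apply)
  qed
  finally show ?thesis by (simp add: det_def)
qed

lemma prod_Basis_vec:
  fixes v :: "real^'n::finite"
  shows "(\<Prod>b\<in>Basis. v \<bullet> b) = (\<Prod>i\<in>UNIV. v $ i)"
proof -
  have "Basis = range (\<lambda>i::'n. axis i (1::real))"
    by (auto simp: Basis_vec_def)
  moreover have inj: "inj (\<lambda>i::'n. axis i (1::real))"
    by (simp add: inj_on_def axis_eq_axis)
  ultimately show ?thesis
    using prod.reindex[OF inj, of "\<lambda>b. v \<bullet> b"] by (simp add: inner_axis)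
qed

text \<open>
  Relabelling coordinates carries boxes to boxes with the same side lengths, and Lebesgue measure is
  determined by its values on boxes.
\<close>

lemma distr_lborel_reindex:
  fixes \<sigma> :: "'m::finite \<Rightarrow> 'n::finite"
  assumes "bij \<sigma>"
  shows "distr lborel borel (\<lambda>x::real^'n. \<chi> j. x $ \<sigma> j) = lborel"
proof (rule sym, rule lborel_eqI)
  let ?P = "\<lambda>x::real^'n. \<chi> j::'m. x $ \<sigma> j"
  have meas: "?P \<in> borel_measurable borel"
    by (intro borel_measurable_continuous_onI continuous_intros)
  fix l u :: "real^'m" assume lu: "\<And>b. b \<in> Basis \<Longrightarrow> l \<bullet> b \<le> u \<bullet> b"
  then have lu': "l $ j \<le> u $ j" for j
    using lu[of "axis j 1"] by (simp add: cart_eq_inner_axis axis_in_Basis_iff)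
  let ?\<tau> = "inv \<sigma>"
  let ?l = "\<chi> i. l $ ?\<tau> i" and ?u = "\<chi> i. u $ ?\<tau> i"
  have "?P -` box l u = box ?l ?u"
  proof -
    have "(\<forall>j. l $ j < x $ \<sigma> j \<and> x $ \<sigma> j < u $ j) \<longleftrightarrow>
        (\<forall>i. l $ ?\<tau> i < x $ i \<and> x $ i < u $ ?\<tau> i)" for x :: "real^'n"
    proof safe
      fix i
      assume "\<forall>j. l $ j < x $ \<sigma> j \<and> x $ \<sigma> j < u $ j"
      from this[rule_format, of "?\<tau> i"] show "l $ ?\<tau> i < x $ i" "x $ i < u $ ?\<tau> i"
        using assms by (simp_all add: bij_is_surj surj_f_inv_f)
    next
      fix j
      assume "\<forall>i. l $ ?\<tau> i < x $ i \<and> x $ i < u $ ?\<tau> i"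
      from this[rule_format, of "\<sigma> j"] show "l $ j < x $ \<sigma> j" "x $ \<sigma> j < u $ j"
        using assms by (simp_all add: bij_is_inj inv_f_f)
    qed
    then show ?thesis by (simp add: set_eq_iff mem_box_cart)
  qed
  then have "emeasure (distr lborel borel ?P) (box l u) = emeasure lborel (box ?l ?u)"
    using meas by (simp add: emeasure_distr)
  also have "\<dots> = ennreal (\<Prod>b\<in>Basis. (?u - ?l) \<bullet> b)"
    using lu' by (intro emeasure_lborel_box) (auto simp: Basis_vec_def inner_axis)
  also have "(\<Prod>b\<in>Basis. (?u - ?l) \<bullet> b) = (\<Prod>i\<in>UNIV. u $ ?\<tau> i - l $ ?\<tau> i)"
    by (simp add: prod_Basis_vec)
  also have "\<dots> = (\<Prod>j\<in>UNIV. u $ j - l $ j)"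
    using prod.reindex_bij_betw[OF bij_imp_bij_inv[OF assms], of "\<lambda>j. u $ j - l $ j"] by simp
  also have "\<dots> = (\<Prod>b\<in>Basis. (u - l) \<bullet> b)"
    by (simp add: prod_Basis_vec)
  finally show "emeasure (distr lborel borel ?P) (box l u) = ennreal (\<Prod>b\<in>Basis. (u - l) \<bullet> b)" .
qed simp

text \<open>
  The formula for extended nonnegative integrals: if one side is finite, both integrands are absolutely
  integrable and the formula for Henstock-Kurzweil integrals applies; otherwise both sides are infinite.
\<close>

lemma nn_integral_change_of_variables_wellorder:
  fixes T :: "real^'m::{finite,wellorder} \<Rightarrow> real^'m::_" and f :: "real^'m::_ \<Rightarrow> real"
  assumes T: "\<And>x. (T has_derivative (*v) (J x)) (at x)" and "bij T"
    and f: "f \<in> borel_measurable borel" and nonneg: "\<And>y. 0 \<le> f y"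
    and J: "(\<lambda>x. det (J x)) \<in> borel_measurable borel"
  shows "(\<integral>\<^sup>+ y. f y \<partial>lborel) = (\<integral>\<^sup>+ x. \<bar>det (J x)\<bar> * f (T x) \<partial>lborel)"
proof -
  let ?D = "\<lambda>x. \<bar>det (J x)\<bar> * f (T x)"
  have "continuous_on UNIV T"
    using T by (meson continuous_at_imp_continuous_on has_derivative_continuous)
  then have [measurable]: "T \<in> borel_measurable borel"
    by (rule borel_measurable_continuous_onI)
  note [measurable] = f J
  have D: "?D \<in> borel_measurable borel" by measurable
  have Dnn: "0 \<le> ?D x" for x using nonneg by simp
  have key: "(?D absolutely_integrable_on UNIV \<and> integral UNIV ?D = b) \<longleftrightarrow>
      (f absolutely_integrable_on UNIV \<and> integral UNIV f = b)" for b
  proof -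
    \<comment> \<open>The formula is about vector-valued integrands, so a real integrand becomes a vector of length one.\<close>
    let ?v = "vec :: real \<Rightarrow> real^1"
    have "((\<lambda>x. \<bar>det (matrix ((*v) (J x)))\<bar> *\<^sub>R ?v (f (T x))) absolutely_integrable_on UNIV \<and>
           integral UNIV (\<lambda>x. \<bar>det (matrix ((*v) (J x)))\<bar> *\<^sub>R ?v (f (T x))) = ?v b) \<longleftrightarrow>
        ((\<lambda>x. ?v (f x)) absolutely_integrable_on (T ` UNIV) \<and>
          integral (T ` UNIV) (\<lambda>x. ?v (f x)) = ?v b)"
      using T \<open>bij T\<close> by (intro has_absolute_integral_change_of_variables)
        (auto simp: bij_def)
    moreover have "\<bar>d\<bar> *\<^sub>R ?v r = ?v (\<bar>d\<bar> * r)" for d r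
      by (simp add: vec_eq_iff)
    ultimately show ?thesis
      using \<open>bij T\<close>
      by (simp add: absolutely_integrable_on_1_iff integral_on_1_eq bij_is_surj)
  qed
  have abs_iff: "h absolutely_integrable_on UNIV \<and> integral UNIV h = b \<longleftrightarrow>
      0 \<le> b \<and> (\<integral>\<^sup>+ x. h x \<partial>lborel) = ennreal b"
    if h: "h \<in> borel_measurable borel" and nn: "\<And>x. 0 \<le> h x" for h :: "real^'m::_ \<Rightarrow> real" and b
  proof -
    have 1: "h absolutely_integrable_on UNIV \<longleftrightarrow> integrable lborel h"
      using h by (simp add: set_integrable_def integrable_completion)
    have 2: "integral UNIV h = integral\<^sup>L lborel h" if "integrable lborel h"
      using integral_lborel[OF that] .
    have 3: "0 \<le> integral\<^sup>L lborel h"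
      using nn by simp
    have 4: "(\<integral>\<^sup>+ x. h x \<partial>lborel) = ennreal b \<longleftrightarrow> integrable lborel h \<and> integral\<^sup>L lborel h = b"
      if "0 \<le> b"
      using nn_integral_eq_integrable[of h lborel b] h nn that by simp
    show ?thesis
      unfolding 1 using 2 3 4 by (cases "integrable lborel h") auto
  qed
  \<comment> \<open>The two integrals take the same finite values, hence they are also infinite together.\<close>
  have eqv: "0 \<le> b \<and> (\<integral>\<^sup>+ x. ?D x \<partial>lborel) = ennreal b \<longleftrightarrow> 0 \<le> b \<and> (\<integral>\<^sup>+ x. f x \<partial>lborel) = ennreal b" for b
    using key abs_iff[OF D Dnn] abs_iff[OF f nonneg] by simp
  show ?thesis
  proof (cases "(\<integral>\<^sup>+ x. f x \<partial>lborel)")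
    case (real r)
    then show ?thesis using eqv[of r] by simp
  next
    case top
    then show ?thesis
      using eqv[of "enn2real (\<integral>\<^sup>+ x. ?D x \<partial>lborel)"]
      by (cases "\<integral>\<^sup>+ x. ?D x \<partial>lborel") auto
  qed
qed

lemma nn_integral_change_of_variables:
  fixes T :: "real^'n::finite \<Rightarrow> real^'n" and f :: "real^'n \<Rightarrow> real"
  assumes T: "\<And>x. (T has_derivative (*v) (J x)) (at x)" and "bij T"
    and f: "f \<in> borel_measurable borel" and nonneg: "\<And>y. 0 \<le> f y"
    and J: "(\<lambda>x. det (J x)) \<in> borel_measurable borel"
  shows "(\<integral>\<^sup>+ y. f y \<partial>lborel) = (\<integral>\<^sup>+ x. \<bar>det (J x)\<bar> * f (T x) \<partial>lborel)"
proof -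
  define P :: "real^'n \<Rightarrow> real^'n ordered_index" where "P x = (\<chi> j. x $ index_of j)" for x
  define Q :: "real^'n ordered_index \<Rightarrow> real^'n" where "Q y = (\<chi> i. y $ Index i)" for y
  have QP: "Q (P x) = x" and PQ: "P (Q y) = y" for x y
    by (auto simp: P_def Q_def vec_eq_iff Index_inverse index_of_inverse)
  have bij_Index: "bij (Index :: 'n \<Rightarrow> 'n ordered_index)"
    by (metis UNIV_I Index_inverse index_of_inverse bijI')
  have lin: "linear P" "linear Q"
    by (auto intro!: linearI simp: P_def Q_def vec_eq_iff)
  have Qm [measurable]: "Q \<in> borel_measurable borel"
    using lin(2) by (intro borel_measurable_continuous_onI linear_continuous_on) (simp add: linear_conv_bounded_linear)
  have distr_Q: "distr lborel borel Q = lborel"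
    unfolding Q_def[abs_def] by (rule distr_lborel_reindex[OF bij_Index])
  have transfer: "(\<integral>\<^sup>+ x. h x \<partial>lborel) = (\<integral>\<^sup>+ y. h (Q y) \<partial>lborel)"
    if "h \<in> borel_measurable borel" for h :: "real^'n \<Rightarrow> ennreal"
    using that by (subst distr_Q[symmetric]) (simp add: nn_integral_distr)
  define K where "K y = (\<chi> i j. J (Q y) $ index_of i $ index_of j)" for y
  have det_K: "det (K y) = det (J (Q y))" for y
    unfolding K_def by (rule det_reindex[OF bij_index_of])
  have K: "(K y) *v v = P (J (Q y) *v Q v)" for y v
    unfolding K_def P_def Q_def matrix_vector_mult_def
    apply (simp add: vec_eq_iff)
    apply (intro allI)
    subgoal for i
      using sum.reindex_bij_betw[OF bij_index_of, of "\<lambda>j. J (Q y) $ index_of i $ j * v $ Index j"]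
      by (simp add: index_of_inverse Q_def)
    done
  have contT: "continuous_on UNIV T"
    using T by (meson continuous_at_imp_continuous_on has_derivative_continuous)
  then have [measurable]: "T \<in> borel_measurable borel"
    by (rule borel_measurable_continuous_onI)
  note [measurable] = f J
  have "(\<integral>\<^sup>+ y. f y \<partial>lborel) = (\<integral>\<^sup>+ y. (f \<circ> Q) y \<partial>lborel)"
    unfolding o_def by (rule transfer) measurable
  also have "\<dots> = (\<integral>\<^sup>+ y. \<bar>det (K y)\<bar> * (f \<circ> Q) ((P \<circ> T \<circ> Q) y) \<partial>lborel)"
  proof (rule nn_integral_change_of_variables_wellorder)
    fix y
    have dP: "(P has_derivative P) (at z)" and dQ: "(Q has_derivative Q) (at z')" for z z'
      using lin by (auto simp: linear_conv_bounded_linear intro: bounded_linear_imp_has_derivative)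
    have "((\<lambda>x. P (T (Q x))) has_derivative (\<lambda>v. P (J (Q y) *v Q v))) (at y)"
      using has_derivative_compose[OF has_derivative_compose[OF dQ T] dP] .
    then show "(P \<circ> T \<circ> Q has_derivative (*v) (K y)) (at y)"
      by (simp add: o_def K[abs_def])
  next
    have "bij P" "bij Q"
      using QP PQ by (metis bijI')+
    then show "bij (P \<circ> T \<circ> Q)"
      using \<open>bij T\<close> by (intro bij_comp)
  next
    show "f \<circ> Q \<in> borel_measurable borel" "(\<lambda>y. det (K y)) \<in> borel_measurable borel"
      unfolding det_K o_def by measurable
  qed (simp add: nonneg)
  also have "\<dots> = (\<integral>\<^sup>+ y. \<bar>det (J (Q y))\<bar> * f (T (Q y)) \<partial>lborel)"
    by (simp add: det_K QP)
  also have "\<dots> = (\<integral>\<^sup>+ x. \<bar>det (J x)\<bar> * f (T x) \<partial>lborel)"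
    by (rule transfer[symmetric]) measurable
  finally show ?thesis .
qed

section \<open>Gradients of convex functions\<close>

text \<open>
  The exceptional set is open and null, and a nonempty open set has positive measure.
\<close>

lemma closed_AE_lborel_imp_all:
  fixes P :: "'a::euclidean_space \<Rightarrow> bool"
  assumes "closed {x. P x}" and "AE x in lborel. P x"
  shows "P x"
proof -
  have "open (- {x. P x})"
    using assms(1) by (simp add: open_closed)
  moreover have "- {x. P x} \<in> null_sets lborel"
    using assms(2) \<open>open (- {x. P x})\<close> by (subst AE_iff_null_sets) (auto simp: borel_open)
  then have "negligible (- {x. P x})"
    by (simp add: negligible_iff_null_sets null_sets_completionI)
  ultimately show ?thesis
    using open_not_negligible by blast
qed

lemma convex_on_above_tangent_plane:
  fixes \<phi> :: "'a::real_inner \<Rightarrow> real"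
  assumes "convex_on UNIV \<phi>" and "GDERIV \<phi> x :> v"
  shows "\<phi> x + v \<bullet> (z - x) \<le> \<phi> z"
proof -
  define h where "h t = \<phi> (x + t *\<^sub>R (z - x))" for t
  have "convex_on UNIV h"
  proof (rule convex_onI)
    fix t a b :: real assume "0 < t" "t < 1"
    then have "\<phi> ((1 - t) *\<^sub>R (x + a *\<^sub>R (z - x)) + t *\<^sub>R (x + b *\<^sub>R (z - x)))
        \<le> (1 - t) * \<phi> (x + a *\<^sub>R (z - x)) + t * \<phi> (x + b *\<^sub>R (z - x))"
      using assms(1) by (intro convex_onD) auto
    then show "h ((1 - t) *\<^sub>R a + t *\<^sub>R b) \<le> (1 - t) * h a + t * h b"
      by (simp add: h_def algebra_simps)
  qed simp
  moreover have "(h has_field_derivative v \<bullet> (z - x)) (at 0)"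
  proof -
    have "(\<phi> has_derivative (\<lambda>w. w \<bullet> v)) (at (x + 0 *\<^sub>R (z - x)))"
      using assms(2) by (simp add: gderiv_def)
    moreover have "((\<lambda>t. x + t *\<^sub>R (z - x)) has_derivative (\<lambda>t. t *\<^sub>R (z - x))) (at 0)"
      by (auto intro!: derivative_eq_intros)
    ultimately have "(h has_derivative (\<lambda>t. (t *\<^sub>R (z - x)) \<bullet> v)) (at 0)"
      unfolding h_def by (rule has_derivative_compose[rotated])
    then show ?thesis
      by (simp add: has_field_derivative_def inner_commute mult.commute[of "(z - x) \<bullet> v"] mult_commute_abs)
  qed
  ultimately have "h 1 - h 0 \<ge> (v \<bullet> (z - x)) * (1 - 0)"
    by (intro convex_on_imp_above_tangent[of UNIV]) auto
  then show ?thesis by (simp add: h_def)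
qed

lemma subgradients_imp_convex_on:
  fixes \<phi> :: "'a::real_inner \<Rightarrow> real"
  assumes "\<And>x z. \<phi> x + v x \<bullet> (z - x) \<le> \<phi> z"
  shows "convex_on UNIV \<phi>"
proof (rule convex_onI)
  fix t :: real and x y :: 'a assume t: "0 < t" "t < 1"
  let ?z = "(1 - t) *\<^sub>R x + t *\<^sub>R y"
  have "(1 - t) * (\<phi> ?z + v ?z \<bullet> (x - ?z)) + t * (\<phi> ?z + v ?z \<bullet> (y - ?z)) \<le> (1 - t) * \<phi> x + t * \<phi> y"
    using t by (intro add_mono mult_left_mono assms) auto
  moreover have "(1 - t) * (\<phi> ?z + v ?z \<bullet> (x - ?z)) + t * (\<phi> ?z + v ?z \<bullet> (y - ?z)) = \<phi> ?z"
  proof -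
    have "(1 - t) *\<^sub>R (x - ?z) + t *\<^sub>R (y - ?z) = 0"
      by (simp add: algebra_simps)
    then have "(1 - t) * (v ?z \<bullet> (x - ?z)) + t * (v ?z \<bullet> (y - ?z)) = 0"
      by (metis inner_add_right inner_scaleR_right inner_zero_right)
    then show ?thesis by (simp add: algebra_simps)
  qed
  ultimately show "\<phi> ?z \<le> (1 - t) * \<phi> x + t * \<phi> y" by simp
qed simp

text \<open>
  A convex function need only be differentiable almost everywhere. But if its gradient agrees almost
  everywhere with a continuous field \<open>T\<close>, then the subgradient inequality
  \<open>\<phi> x + T x \<bullet> (z - x) \<le> \<phi> z\<close> holds on a set of full measure and is closed in \<open>x\<close>, so it holds
  everywhere. Using it from both ends squeezes the remainder of the first-order expansion between \<open>0\<close>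
  and \<open>(T z - T x) \<bullet> (z - x)\<close>.
\<close>

lemma convex_gradient_everywhere:
  fixes \<phi> :: "'a::euclidean_space \<Rightarrow> real"
  assumes conv: "convex_on UNIV \<phi>" and T: "continuous_on UNIV T"
    and ae: "AE x in lborel. GDERIV \<phi> x :> T x"
  shows "GDERIV \<phi> x :> T x"
proof -
  have cont: "continuous_on UNIV \<phi>"
    using conv by (intro convex_on_continuous) auto
  have sub: "\<phi> x + T x \<bullet> (z - x) \<le> \<phi> z" for x z
  proof (rule closed_AE_lborel_imp_all[of _ x])
    show "closed {x. \<phi> x + T x \<bullet> (z - x) \<le> \<phi> z}"
      by (intro closed_Collect_le continuous_intros cont T)
    show "AE x in lborel. \<phi> x + T x \<bullet> (z - x) \<le> \<phi> z"
      using ae by eventually_elim (rule convex_on_above_tangent_plane[OF conv])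
  qed
  have sandwich: "norm (\<phi> y - \<phi> x - (y - x) \<bullet> T x) \<le> norm (T y - T x) * norm (y - x)" for y
  proof -
    have "0 \<le> \<phi> y - \<phi> x - (y - x) \<bullet> T x"
      using sub[of x y] by (simp add: inner_commute)
    moreover have "\<phi> y - \<phi> x - (y - x) \<bullet> T x \<le> (T y - T x) \<bullet> (y - x)"
      using sub[of y x] by (simp add: inner_diff inner_commute)
    moreover have "(T y - T x) \<bullet> (y - x) \<le> norm (T y - T x) * norm (y - x)"
      by (rule norm_cauchy_schwarz)
    ultimately show ?thesis by simp
  qed
  show ?thesis
    unfolding gderiv_def has_derivative_at_alt
  proof (intro conjI allI impI)
    fix e :: real assume "0 < e"
    then obtain d where "d > 0" and d: "\<And>y. dist y x < d \<Longrightarrow> dist (T y) (T x) < e"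
      using T by (metis UNIV_I continuous_on_iff)
    have "norm (\<phi> y - \<phi> x - (y - x) \<bullet> T x) \<le> e * norm (y - x)" if "norm (y - x) < d" for y
      using sandwich[of y] d[of y] that
      by (smt (verit) dist_norm mult_right_mono norm_ge_zero)
    then show "\<exists>d>0. \<forall>y. norm (y - x) < d \<longrightarrow>
        norm (\<phi> y - \<phi> x - (y - x) \<bullet> T x) \<le> e * norm (y - x)"
      using \<open>d > 0\<close> by blast
  qed (rule bounded_linear_inner_left)
qed

section \<open>Optimality of small gradient perturbations of the identity\<close>

text \<open>
  The map \<open>x \<mapsto> x + \<nabla>u x\<close> for a bounded \<open>u\<close> whose gradient \<open>g\<close> is bounded with Lipschitz constant below
  \<open>1/2\<close>. This is strong enough to make \<open>|x|\<^sup>2 / 2 + u x\<close> strictly convex, with room to spare, so that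
  optimality and uniqueness can be read off from one pointwise inequality.
\<close>

locale gradient_perturbation =
  fixes u :: "real^'n \<Rightarrow> real" and g :: "real^'n \<Rightarrow> real^'n" and L :: real
  assumes gradient: "GDERIV u x :> g x"
    and lipschitz: "norm (g x - g z) \<le> L * norm (x - z)"
    and L_nonneg: "0 \<le> L" and L_small: "L < 1/2"
    and bounded_u: "bounded (range u)" and bounded_g: "bounded (range g)"
begin

definition transport :: "real^'n \<Rightarrow> real^'n" where
  "transport x = x + g x"

definition potential :: "real^'n \<Rightarrow> real" where
  "potential x = (norm x)\<^sup>2 / 2 + u x"

lemma taylor: "\<bar>u x - u z - g z \<bullet> (x - z)\<bar> \<le> L * (norm (x - z))\<^sup>2"
proof -
  \<comment> \<open>Without its linear part at z, the function has gradient of size at most L |x - z| on the segment.\<close>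
  define f where "f w = u w - g z \<bullet> w" for w
  have "norm (f x - f z) \<le> (L * norm (x - z)) * norm (x - z)"
  proof (rule differentiable_bound[of "closed_segment z x"])
    fix w assume w: "w \<in> closed_segment z x"
    show "(f has_derivative (\<lambda>h. h \<bullet> (g w - g z))) (at w within closed_segment z x)"
    proof -
      have "(u has_derivative (\<lambda>h. h \<bullet> g w)) (at w within closed_segment z x)"
        using gradient[of w] unfolding gderiv_def by (rule has_derivative_at_withinI)
      moreover have "((\<lambda>w. g z \<bullet> w) has_derivative (\<lambda>h. g z \<bullet> h)) (at w within closed_segment z x)"
        by (intro bounded_linear_imp_has_derivative bounded_linear_inner_right)
      ultimately have "(f has_derivative (\<lambda>h. h \<bullet> g w - g z \<bullet> h)) (at w within closed_segment z x)"
        unfolding f_def by (rule has_derivative_diff)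
      then show ?thesis by (simp add: inner_diff_right inner_commute)
    qed
    show "onorm (\<lambda>h. h \<bullet> (g w - g z)) \<le> L * norm (x - z)"
    proof (rule onorm_bound)
      fix h
      have "norm (h \<bullet> (g w - g z)) \<le> norm h * norm (g w - g z)"
        by (simp add: Cauchy_Schwarz_ineq2)
      also have "\<dots> \<le> norm h * (L * norm (x - z))"
      proof (intro mult_left_mono norm_ge_zero)
        have "norm (w - z) \<le> norm (x - z)"
          using segment_bound(1)[OF w] by (simp add: norm_minus_commute)
        then show "norm (g w - g z) \<le> L * norm (x - z)"
          using lipschitz[of w z] L_nonneg by (meson mult_left_mono order_trans)
      qed
      finally show "norm (h \<bullet> (g w - g z)) \<le> L * norm (x - z) * norm h"
        by (simp add: mult.commute)
    qed (simp add: L_nonneg)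
  qed auto
  then show ?thesis
    by (simp add: f_def inner_diff_right power2_eq_square algebra_simps)
qed

text \<open>
  A quantitative form of Kantorovich duality. The first three terms on the right are the sum of a function of the
  source \<open>x\<close> and a function of the target \<open>y = transport z\<close>, and for \<open>x = z\<close> both sides are equal. The
  last term measures how far \<open>x\<close> is from the point that is transported to \<open>y\<close>.
\<close>

lemma cost_lower_bound:
  "(norm (x - transport z))\<^sup>2 \<ge> - 2 * u x + 2 * u z + (norm (g z))\<^sup>2 + (1 - 2 * L) * (norm (x - z))\<^sup>2"
proof -
  have "(norm (x - transport z))\<^sup>2 = (norm (x - z))\<^sup>2 - 2 * (g z \<bullet> (x - z)) + (norm (g z))\<^sup>2"
    unfolding transport_def power2_norm_eq_inner
    by (simp add: inner_diff inner_add inner_commute algebra_simps)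
  then show ?thesis
    using taylor[of x z] by (simp add: algebra_simps abs_le_iff)
qed

lemma continuous_g: "continuous_on UNIV g"
  using lipschitz L_nonneg
  by (intro lipschitz_on_continuous_on[of L] lipschitz_onI) (auto simp: dist_norm)

lemma continuous_u: "continuous_on UNIV u"
  using gradient by (meson continuous_at_imp_continuous_on gderiv_def has_derivative_continuous)

lemma continuous_transport: "continuous_on UNIV transport"
  unfolding transport_def by (intro continuous_intros continuous_g)

lemma transport_expands: "(1 - L) * norm (x - z) \<le> norm (transport x - transport z)"
proof -
  have "norm (x - z) \<le> norm (transport x - transport z) + norm (g x - g z)"
    unfolding transport_def by norm
  then show ?thesis using lipschitz[of x z] by (simp add: algebra_simps)
qed

text \<open>
  Injectivity holds since \<open>transport\<close> shrinks distances by at most the factor \<open>1 - L\<close>. A preimage of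
  \<open>y\<close> is a fixed point of the contraction \<open>x \<mapsto> y - g x\<close>.
\<close>

lemma bij_transport: "bij transport"
proof (rule bijI)
  show "inj transport"
  proof (rule injI)
    fix x z assume "transport x = transport z"
    then show "x = z"
      using transport_expands[of x z] L_small by (simp add: mult_le_0_iff)
  qed
  have "\<exists>x. y = transport x" for y
  proof -
    have "\<exists>!x. y - g x = x"
      using L_nonneg L_small lipschitz
      by (intro banach_fix_type[of L]) (auto simp: dist_norm norm_minus_commute)
    then show ?thesis by (metis add.commute diff_add_cancel transport_def)
  qed
  then show "surj transport" by (auto simp: surj_def)
qed

lemma inv_transport_simps [simp]: "inv transport (transport x) = x" "transport (inv transport y) = y"
  using bij_transport by (simp_all add: bij_is_inj bij_is_surj inv_f_f surj_f_inv_f)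

lemma continuous_inv_transport: "continuous_on UNIV (inv transport)"
proof (rule lipschitz_on_continuous_on[of "1 / (1 - L)"], rule lipschitz_onI)
  fix x y
  have "(1 - L) * dist (inv transport x) (inv transport y) \<le> dist x y"
    using transport_expands[of "inv transport x" "inv transport y"] by (simp add: dist_norm)
  then show "dist (inv transport x) (inv transport y) \<le> 1 / (1 - L) * dist x y"
    using L_small by (simp add: field_simps)
qed (use L_small in auto)

lemma measurable_perturbation [measurable]:
  "u \<in> borel_measurable borel" "g \<in> borel_measurable borel"
  "transport \<in> borel_measurable borel" "inv transport \<in> borel_measurable borel"
  using continuous_u continuous_g continuous_transport continuous_inv_transport
  by (auto intro: borel_measurable_continuous_onI)

lemma gradient_potential: "GDERIV potential x :> transport x"
proof -
  have "((\<lambda>x. (x \<bullet> x) / 2 + u x) has_derivative (\<lambda>h. h \<bullet> (x + g x))) (at x)"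
  proof -
    have "((\<lambda>x. (x \<bullet> x) / 2) has_derivative (\<lambda>h. h \<bullet> x)) (at x)"
      by (rule has_derivative_eq_rhs, (rule derivative_intros)+) (auto simp: inner_commute)
    from has_derivative_add[OF this gradient[of x, unfolded gderiv_def]] show ?thesis
      by (simp add: inner_add_right)
  qed
  then show ?thesis
    by (simp add: gderiv_def potential_def[abs_def] transport_def power2_norm_eq_inner)
qed

lemma convex_potential_transport: "convex_potential \<mu> transport potential"
proof -
  have "potential z + transport z \<bullet> (x - z) \<le> potential x" for x z
  proof -
    have "potential x - potential z - transport z \<bullet> (x - z)
        = (norm (x - z))\<^sup>2 / 2 + (u x - u z - g z \<bullet> (x - z))"
      unfolding potential_def transport_def power2_norm_eq_inner
      by (simp add: inner_diff inner_add inner_commute field_simps)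
    also have "\<dots> \<ge> (1/2 - L) * (norm (x - z))\<^sup>2"
      using taylor[of x z] by (simp add: algebra_simps abs_le_iff)
    moreover have "(1/2 - L) * (norm (x - z))\<^sup>2 \<ge> 0"
      using L_small by simp
    ultimately show ?thesis by simp
  qed
  then have "convex_on UNIV potential"
    by (rule subgradients_imp_convex_on)
  then show ?thesis
    by (simp add: convex_potential_def gradient_potential)
qed

text \<open>
  Integrate the lower bound of the cost with \<open>y = S x\<close>. The integral of the target term depends only on the distribution
  of \<open>S\<close>, which is that of \<open>transport\<close>; and for \<open>transport\<close> the bound is an equality. What remains is the
  quadratic gap. All potentials are bounded, so every integral is finite once the cost of \<open>S\<close> is.
\<close>

lemma transport_cost_gap:
  assumes "prob_space \<mu>" and sets: "sets \<mu> = sets borel"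
    and S: "transport_map \<mu> (distr \<mu> borel transport) S"
    and fin: "transport_cost \<mu> S < \<infinity>"
  shows "transport_cost \<mu> transport +
      (\<integral>\<^sup>+ x. ennreal ((1 - 2 * L) * (norm (x - inv transport (S x)))\<^sup>2) \<partial>\<mu>) \<le> transport_cost \<mu> S"
proof -
  interpret prob_space \<mu> by fact
  note [measurable_cong] = sets
  have S_meas [measurable]: "S \<in> borel_measurable borel"
    and S_distr: "distr \<mu> borel S = distr \<mu> borel transport"
    using S by (auto simp: transport_map_def)
  have space: "space \<mu> = UNIV"
    using sets_eq_imp_space_eq[OF sets] by simp
  let ?R = "inv transport"
  \<comment> \<open>The dual potential on the target side.\<close>
  define \<beta> where "\<beta> y = 2 * u (?R y) + (norm (g (?R y)))\<^sup>2" for y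
  have \<beta>_meas [measurable]: "\<beta> \<in> borel_measurable borel"
    unfolding \<beta>_def by measurable
  obtain Bu where Bu: "\<And>x. norm (u x) \<le> Bu" using bounded_u by (auto simp: bounded_iff)
  obtain Bg where Bg: "\<And>x. norm (g x) \<le> Bg" using bounded_g by (auto simp: bounded_iff)
  have g2: "(norm (g x))\<^sup>2 \<le> Bg\<^sup>2" for x
    using Bg[of x] by (intro power_mono) auto
  have "\<bar>\<beta> y\<bar> \<le> 2 * Bu + Bg\<^sup>2" for y
    using Bu[of "?R y"] g2[of "?R y"] unfolding \<beta>_def
    by (auto simp: abs_le_iff) (smt (verit) zero_le_power2)+
  then have \<beta>_int: "integrable \<mu> (\<lambda>x. \<beta> (h x))" if "h \<in> borel_measurable borel" for h
    using that by (intro integrable_const_bound[of _ "2 * Bu + Bg\<^sup>2"]) auto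
  have u_int: "integrable \<mu> u"
    using Bu by (intro integrable_const_bound[of _ Bu]) auto
  have g_int: "integrable \<mu> (\<lambda>x. (norm (g x))\<^sup>2)"
    using g2 by (intro integrable_const_bound[of _ "Bg\<^sup>2"]) auto
  have \<beta>_eq: "(LINT x|\<mu>. \<beta> (S x)) = (LINT x|\<mu>. \<beta> (transport x))"
  proof -
    have "(LINT x|\<mu>. \<beta> (S x)) = (LINT y|distr \<mu> borel S. \<beta> y)"
      by (simp add: integral_distr)
    also have "\<dots> = (LINT x|\<mu>. \<beta> (transport x))"
      unfolding S_distr by (simp add: integral_distr)
    finally show ?thesis .
  qed
  have cost_T: "transport_cost \<mu> transport = ennreal (LINT x|\<mu>. (norm (g x))\<^sup>2)"
    unfolding transport_cost_def transport_def
    using g_int by (simp add: nn_integral_eq_integral)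
  have S_int: "integrable \<mu> (\<lambda>x. (norm (x - S x))\<^sup>2)"
    using fin unfolding transport_cost_def
    by (intro integrableI_nonneg) (auto simp: less_top)
  have cost_S: "transport_cost \<mu> S = ennreal (LINT x|\<mu>. (norm (x - S x))\<^sup>2)"
    unfolding transport_cost_def using S_int by (simp add: nn_integral_eq_integral)
  have gap: "(1 - 2 * L) * (norm (x - ?R (S x)))\<^sup>2 \<le> (norm (x - S x))\<^sup>2 + 2 * u x - \<beta> (S x)" for x
    using cost_lower_bound[of x "?R (S x)"] by (simp add: \<beta>_def)
  have gap_nonneg: "0 \<le> (1 - 2 * L) * (norm (x - ?R (S x)))\<^sup>2" for x
    using L_small by simp
  have bound_int: "integrable \<mu> (\<lambda>x. (norm (x - S x))\<^sup>2 + 2 * u x - \<beta> (S x))"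
    using S_int u_int \<beta>_int[OF S_meas] by simp
  have gap_int: "integrable \<mu> (\<lambda>x. (1 - 2 * L) * (norm (x - ?R (S x)))\<^sup>2)"
    using gap gap_nonneg by (intro Bochner_Integration.integrable_bound[OF bound_int]) (auto intro: order_trans[OF _ abs_ge_self])
  have "(LINT x|\<mu>. (1 - 2 * L) * (norm (x - ?R (S x)))\<^sup>2) \<le>
      (LINT x|\<mu>. (norm (x - S x))\<^sup>2 + 2 * u x - \<beta> (S x))"
    by (intro integral_mono gap gap_int bound_int)
  also have "\<dots> = (LINT x|\<mu>. (norm (x - S x))\<^sup>2) + 2 * (LINT x|\<mu>. u x) - (LINT x|\<mu>. \<beta> (transport x))"
    using S_int u_int \<beta>_int[OF S_meas] by (simp add: \<beta>_eq)
  also have "(LINT x|\<mu>. \<beta> (transport x)) = 2 * (LINT x|\<mu>. u x) + (LINT x|\<mu>. (norm (g x))\<^sup>2)"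
    using u_int g_int by (simp add: \<beta>_def)
  finally have "(LINT x|\<mu>. (norm (g x))\<^sup>2) + (LINT x|\<mu>. (1 - 2 * L) * (norm (x - ?R (S x)))\<^sup>2)
      \<le> (LINT x|\<mu>. (norm (x - S x))\<^sup>2)"
    by simp
  moreover have "(\<integral>\<^sup>+ x. ennreal ((1 - 2 * L) * (norm (x - ?R (S x)))\<^sup>2) \<partial>\<mu>)
      = ennreal (LINT x|\<mu>. (1 - 2 * L) * (norm (x - ?R (S x)))\<^sup>2)"
    using gap_int gap_nonneg by (intro nn_integral_eq_integral) auto
  moreover have "0 \<le> (LINT x|\<mu>. (1 - 2 * L) * (norm (x - ?R (S x)))\<^sup>2)"
    by (intro integral_nonneg_AE AE_I2 gap_nonneg)
  ultimately show ?thesis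
    unfolding cost_T cost_S
    by (simp add: ennreal_plus[symmetric] del: ennreal_plus)
qed

lemma optimal_transport_transport:
  assumes "prob_space \<mu>" and "sets \<mu> = sets borel"
  shows "optimal_transport \<mu> (distr \<mu> borel transport) transport"
  unfolding optimal_transport_def
proof (intro conjI allI impI)
  show "transport_map \<mu> (distr \<mu> borel transport) transport"
    by (simp add: transport_map_def)
  fix S assume S: "transport_map \<mu> (distr \<mu> borel transport) S"
  show "transport_cost \<mu> transport \<le> transport_cost \<mu> S"
  proof (cases "transport_cost \<mu> S < \<infinity>")
    case True
    have "transport_cost \<mu> transport \<le> transport_cost \<mu> transport +
      (\<integral>\<^sup>+ x. ennreal ((1 - 2 * L) * (norm (x - inv transport (S x)))\<^sup>2) \<partial>\<mu>)"
      by simp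
    also have "\<dots> \<le> transport_cost \<mu> S"
      by (rule transport_cost_gap[OF assms S True])
    finally show ?thesis .
  next
    case False
    then have "transport_cost \<mu> S = top" by (metis less_top infinity_ennreal_def)
    then show ?thesis by simp
  qed
qed

lemma transport_cost_finite:
  assumes "prob_space \<mu>"
  shows "transport_cost \<mu> transport < \<infinity>"
proof -
  interpret prob_space \<mu> by fact
  obtain B where B: "\<And>x. norm (g x) \<le> B" using bounded_g by (auto simp: bounded_iff)
  have "transport_cost \<mu> transport \<le> (\<integral>\<^sup>+ x. ennreal (B\<^sup>2) \<partial>\<mu>)"
    unfolding transport_cost_def transport_def
    using B by (intro nn_integral_mono ennreal_leI) (simp add: power_mono)
  also have "\<dots> < \<infinity>"
    by (simp add: emeasure_space_1)
  finally show ?thesis .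
qed

text \<open>
  An optimal \<open>S\<close> has no gap, that is \<open>x = inv transport (S x)\<close> almost everywhere.
\<close>

lemma optimal_transport_unique:
  assumes \<mu>: "prob_space \<mu>" "sets \<mu> = sets borel"
    and S: "optimal_transport \<mu> (distr \<mu> borel transport) S"
  shows "AE x in \<mu>. S x = transport x"
proof -
  note [measurable_cong] = \<mu>(2)
  have S_map: "transport_map \<mu> (distr \<mu> borel transport) S"
    using S by (simp add: optimal_transport_def)
  then have [measurable]: "S \<in> borel_measurable borel"
    by (simp add: transport_map_def)
  have le: "transport_cost \<mu> S \<le> transport_cost \<mu> transport"
    using S optimal_transport_transport[OF \<mu>] by (simp add: optimal_transport_def)
  then have fin: "transport_cost \<mu> S < \<infinity>"
    using transport_cost_finite[OF \<mu>(1)] by (rule order_le_less_trans)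
  let ?gap = "\<integral>\<^sup>+ x. ennreal ((1 - 2 * L) * (norm (x - inv transport (S x)))\<^sup>2) \<partial>\<mu>"
  have "transport_cost \<mu> transport + ?gap \<le> transport_cost \<mu> transport + 0"
    using transport_cost_gap[OF \<mu> S_map fin] le by (simp only: add_0_right)
  then have "?gap = 0"
    using transport_cost_finite[OF \<mu>(1)]
    by (subst (asm) ennreal_add_left_cancel_le) (auto dest: order_trans)
  then have "AE x in \<mu>. ennreal ((1 - 2 * L) * (norm (x - inv transport (S x)))\<^sup>2) = 0"
    by (subst (asm) nn_integral_0_iff_AE) measurable
  then show ?thesis
  proof eventually_elim
    fix x assume "ennreal ((1 - 2 * L) * (norm (x - inv transport (S x)))\<^sup>2) = 0"
    then have "(1 - 2 * L) * (norm (x - inv transport (S x)))\<^sup>2 \<le> 0"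
      by (simp add: ennreal_eq_0_iff)
    then have "x = inv transport (S x)"
      using L_small by (simp add: mult_le_0_iff)
    then show "S x = transport x" by (metis inv_transport_simps(2))
  qed
qed

end

section \<open>Integration by parts\<close>

lemma integrable_continuous_compact_support:
  fixes f :: "'a::euclidean_space \<Rightarrow> real"
  assumes "continuous_on UNIV f" and "compact K" and "\<And>x. x \<notin> K \<Longrightarrow> f x = 0"
  shows "integrable lborel f"
proof -
  have "integrable lborel (\<lambda>x. indicator K x *\<^sub>R f x)"
    using assms by (intro borel_integrable_compact) (auto intro: continuous_on_subset)
  also have "(\<lambda>x. indicator K x *\<^sub>R f x) = f"
    using assms(3) by (auto simp: fun_eq_iff indicator_def split: if_splits)
  finally show ?thesis .
qed

lemma integral_lborel_translation:
  fixes f :: "'a::euclidean_space \<Rightarrow> real"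
  assumes "f \<in> borel_measurable borel"
  shows "(LINT x|lborel. f (x + v)) = (LINT x|lborel. f x)"
proof -
  have "(LINT x|lborel. f x) = (LINT x|distr lborel borel ((+) v). f x)"
    by (simp add: lborel_distr_plus)
  also have "\<dots> = (LINT x|lborel. f (v + x))"
    using assms by (subst integral_distr) auto
  finally show ?thesis by (simp add: add.commute)
qed

lemma has_derivative_zero_off_support:
  fixes F :: "'a::real_normed_vector \<Rightarrow> real"
  assumes "(F has_derivative F') (at x)" and "closed K" and "\<And>x. x \<notin> K \<Longrightarrow> F x = 0" and "x \<notin> K"
  shows "F' = (\<lambda>_. 0)"
proof -
  have "((\<lambda>_. 0) has_derivative (\<lambda>_. 0)) (at x)" by simp
  then have "(F has_derivative (\<lambda>_. 0)) (at x)"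
    by (rule has_derivative_transform_within_open[where s = "- K"]) (use assms in auto)
  then show ?thesis
    using assms(1) has_derivative_unique by blast
qed

text \<open>
  The difference quotients of \<open>F\<close> have integral zero because Lebesgue measure is translation invariant,
  and they converge to the directional derivative, dominated by a constant on a fixed ball.
\<close>

lemma integral_directional_derivative_eq_0:
  fixes F :: "'a::euclidean_space \<Rightarrow> real"
  assumes F: "\<And>x. (F has_derivative F' x) (at x)" and cont: "continuous_on UNIV (\<lambda>x. F' x v)"
    and K: "compact K" and supp: "\<And>x. x \<notin> K \<Longrightarrow> F x = 0"
  shows "(LINT x|lborel. F' x v) = 0"
proof -
  have F_cont: "continuous_on UNIV F"
    using F by (meson continuous_at_imp_continuous_on has_derivative_continuous)
  then have F_meas [measurable]: "F \<in> borel_measurable borel"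
    by (rule borel_measurable_continuous_onI)
  have F_int: "integrable lborel F"
    by (rule integrable_continuous_compact_support[OF F_cont K supp])
  have F'_off: "F' x v = 0" if "x \<notin> K" for x
    using has_derivative_zero_off_support[OF F compact_imp_closed[OF K] supp that] by simp
  obtain B where B: "\<And>x. \<bar>F' x v\<bar> \<le> B"
  proof -
    have "compact ((\<lambda>x. F' x v) ` K)"
      using K cont by (intro compact_continuous_image continuous_on_subset[OF cont]) auto
    then have "bounded ((\<lambda>x. F' x v) ` K)" by (rule compact_imp_bounded)
    then obtain B where "\<And>x. x \<in> K \<Longrightarrow> \<bar>F' x v\<bar> \<le> B"
      unfolding bounded_iff by auto
    then have "\<bar>F' x v\<bar> \<le> max B 0" for x
      using F'_off[of x] by (cases "x \<in> K") (auto simp: le_max_iff_disj)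
    then show thesis by (rule that)
  qed
  obtain r where r: "\<And>x. x \<in> K \<Longrightarrow> norm x \<le> r"
    using compact_imp_bounded[OF K] by (auto simp: bounded_iff)
  define t where "t n = 1 / real (Suc n)" for n
  have t: "0 < t n" "t n \<le> 1" for n by (auto simp: t_def)
  define q where "q n x = (F (x + t n *\<^sub>R v) - F x) / t n" for n x
  let ?K = "cball 0 (r + norm v) :: 'a set"
  \<comment> \<open>The mean value theorem bounds the quotients by the bound of the directional derivative.\<close>
  have mvt: "\<exists>y. q n x = F' y v" for n x
  proof -
    have "\<exists>\<xi>\<in>{0..1}. F (x + 1 *\<^sub>R (t n *\<^sub>R v)) - F (x + 0 *\<^sub>R (t n *\<^sub>R v)) =
        (1 - 0) * F' (x + \<xi> *\<^sub>R (t n *\<^sub>R v)) (t n *\<^sub>R v)"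
    proof -
      have d: "((\<lambda>s. F (x + s *\<^sub>R (t n *\<^sub>R v))) has_real_derivative F' (x + s *\<^sub>R (t n *\<^sub>R v)) (t n *\<^sub>R v)) (at s)" for s
      proof -
        have "((\<lambda>s. x + s *\<^sub>R (t n *\<^sub>R v)) has_derivative (\<lambda>h. h *\<^sub>R (t n *\<^sub>R v))) (at s)"
          by (auto intro!: derivative_eq_intros)
        from has_derivative_compose[OF this F]
        have "((\<lambda>s. F (x + s *\<^sub>R (t n *\<^sub>R v))) has_derivative (\<lambda>h. F' (x + s *\<^sub>R (t n *\<^sub>R v)) (h *\<^sub>R (t n *\<^sub>R v)))) (at s)" .
        moreover have "F' (x + s *\<^sub>R (t n *\<^sub>R v)) (h *\<^sub>R (t n *\<^sub>R v)) = F' (x + s *\<^sub>R (t n *\<^sub>R v)) (t n *\<^sub>R v) * h" for h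
          using linear_scale[OF has_derivative_linear[OF F]] by simp
        ultimately show ?thesis by (simp add: has_field_derivative_def)
      qed
      show ?thesis
        using MVT2[OF zero_less_one, of "\<lambda>s. F (x + s *\<^sub>R (t n *\<^sub>R v))", OF d]
        by (metis atLeastAtMost_iff less_eq_real_def)
    qed
    then obtain \<xi> where "F (x + t n *\<^sub>R v) - F x = F' (x + \<xi> *\<^sub>R (t n *\<^sub>R v)) (t n *\<^sub>R v)"
      by auto
    also have "\<dots> = t n * F' (x + \<xi> *\<^sub>R (t n *\<^sub>R v)) v"
      using linear_scale[OF has_derivative_linear[OF F]] by simp
    finally show ?thesis
      using t(1)[of n] by (auto simp: q_def)
  qed
  have q_off: "q n x = 0" if "x \<notin> ?K" for n x
  proof -
    have "norm (t n *\<^sub>R v) \<le> norm v"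
      using t[of n] by (simp add: mult_left_le_one_le)
    then have "x \<notin> K" "x + t n *\<^sub>R v \<notin> K"
      using that r[of x] r[of "x + t n *\<^sub>R v"] norm_triangle_ineq4[of "x + t n *\<^sub>R v" "t n *\<^sub>R v"]
      using norm_ge_zero[of v] by (auto simp del: norm_ge_zero)
    then show ?thesis by (simp add: q_def supp)
  qed
  have "(\<lambda>n. LINT x|lborel. q n x) \<longlonglongrightarrow> (LINT x|lborel. F' x v)"
  proof (rule integral_dominated_convergence)
    show "(\<lambda>x. F' x v) \<in> borel_measurable lborel"
      using cont by (simp add: borel_measurable_continuous_onI)
    show "q n \<in> borel_measurable lborel" for n
      unfolding q_def by measurable
    show "integrable lborel (\<lambda>x. indicator ?K x *\<^sub>R B)"
      by (intro borel_integrable_compact) auto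
    show "AE x in lborel. (\<lambda>n. q n x) \<longlonglongrightarrow> F' x v"
    proof (rule AE_I2)
      fix x
      have t0: "t \<longlonglongrightarrow> 0"
        unfolding t_def using LIMSEQ_inverse_real_of_nat by (simp add: inverse_eq_divide)
      have "((\<lambda>s. x + s *\<^sub>R v) has_derivative (\<lambda>h. h *\<^sub>R v)) (at 0)"
        by (auto intro!: derivative_eq_intros)
      moreover have "(F has_derivative F' x) (at (x + 0 *\<^sub>R v))" using F[of x] by simp
      ultimately have "((\<lambda>s. F (x + s *\<^sub>R v)) has_derivative (\<lambda>h. F' x (h *\<^sub>R v))) (at 0)"
        by (rule has_derivative_compose)
      moreover have "F' x (h *\<^sub>R v) = F' x v * h" for h
        using linear_scale[OF has_derivative_linear[OF F[of x]]] by simp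
      ultimately have "((\<lambda>s. F (x + s *\<^sub>R v)) has_real_derivative F' x v) (at 0)"
        by (simp add: has_field_derivative_def)
      then have "((\<lambda>h. (F (x + h *\<^sub>R v) - F x) / h) \<longlongrightarrow> F' x v) (at 0)"
        by (simp add: has_field_derivative_iff)
      moreover have "filterlim t (at 0) sequentially"
        using t0 t(1) by (auto simp: filterlim_at intro!: always_eventually) (metis less_irrefl)
      ultimately show "(\<lambda>n. q n x) \<longlonglongrightarrow> F' x v"
        unfolding q_def by (rule filterlim_compose)
    qed
    show "AE x in lborel. norm (q n x) \<le> indicator ?K x *\<^sub>R B" for n
    proof (rule AE_I2)
      fix x
      show "norm (q n x) \<le> indicator ?K x *\<^sub>R B"
        using mvt[of n x] B q_off[of x n] by (cases "x \<in> ?K") (auto simp: indicator_def)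
    qed
  qed
  moreover have "(LINT x|lborel. q n x) = 0" for n
  proof -
    have "integrable lborel (\<lambda>x. F (x + t n *\<^sub>R v))"
    proof (rule integrable_continuous_compact_support[where K = ?K])
      show "continuous_on UNIV (\<lambda>x. F (x + t n *\<^sub>R v))"
        by (intro continuous_on_compose2[OF F_cont] continuous_intros) auto
      fix x :: 'a assume "x \<notin> ?K"
      have "norm (t n *\<^sub>R v) \<le> norm v"
        using t[of n] by (simp add: mult_left_le_one_le)
      then have "x + t n *\<^sub>R v \<notin> K"
        using \<open>x \<notin> ?K\<close> r[of "x + t n *\<^sub>R v"] norm_triangle_ineq4[of "x + t n *\<^sub>R v" "t n *\<^sub>R v"]
        by auto
      then show "F (x + t n *\<^sub>R v) = 0" by (rule supp)
    qed simp
    then show ?thesis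
      using F_int by (simp add: q_def integral_lborel_translation)
  qed
  ultimately show ?thesis
    by (simp add: LIMSEQ_const_iff)
qed

lemma differentiable_on_UNIV_I:
  assumes "\<And>x. (f has_derivative f' x) (at x)"
  shows "f differentiable_on UNIV"
  unfolding differentiable_on_def using differentiableI[OF assms] by simp

lemma partial_deriv_eq: "(f has_derivative f') (at x) \<Longrightarrow> partial_deriv i f x = f' (axis i 1)"
  unfolding partial_deriv_def by (simp add: frechet_derivative_at[symmetric])

lemma integral_by_parts_partial_deriv:
  fixes f \<psi> :: "real^'n \<Rightarrow> real"
  assumes f: "f differentiable_on UNIV" and f': "continuous_on UNIV (partial_deriv i f)"
    and \<psi>: "\<psi> differentiable_on UNIV" and \<psi>': "continuous_on UNIV (partial_deriv i \<psi>)"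
    and K: "compact K" and supp: "\<And>x. x \<notin> K \<Longrightarrow> \<psi> x = 0"
  shows "(LINT x|lborel. f x * partial_deriv i \<psi> x) = - (LINT x|lborel. partial_deriv i f x * \<psi> x)"
proof -
  let ?v = "axis i (1::real)"
  have df: "(f has_derivative frechet_derivative f (at x)) (at x)" for x
    using f by (simp add: differentiable_on_def frechet_derivative_works)
  have d\<psi>: "(\<psi> has_derivative frechet_derivative \<psi> (at x)) (at x)" for x
    using \<psi> by (simp add: differentiable_on_def frechet_derivative_works)
  have cf: "continuous_on UNIV f" and c\<psi>: "continuous_on UNIV \<psi>"
    using f \<psi> by (auto intro: differentiable_imp_continuous_on)
  have off: "partial_deriv i \<psi> x = 0" if "x \<notin> K" for x
    using has_derivative_zero_off_support[OF d\<psi> compact_imp_closed[OF K] supp that]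
    by (simp add: partial_deriv_def)
  have i1: "integrable lborel (\<lambda>x. f x * partial_deriv i \<psi> x)"
    using off by (intro integrable_continuous_compact_support[OF _ K] continuous_intros cf \<psi>') auto
  have i2: "integrable lborel (\<lambda>x. partial_deriv i f x * \<psi> x)"
    using supp by (intro integrable_continuous_compact_support[OF _ K] continuous_intros c\<psi> f') auto
  have "(LINT x|lborel. f x * frechet_derivative \<psi> (at x) ?v + frechet_derivative f (at x) ?v * \<psi> x) = 0"
  proof (rule integral_directional_derivative_eq_0[OF has_derivative_mult[OF df d\<psi>] _ K])
    show "continuous_on UNIV (\<lambda>x. f x * frechet_derivative \<psi> (at x) ?v + frechet_derivative f (at x) ?v * \<psi> x)"
      using f' \<psi>' unfolding partial_deriv_def by (intro continuous_intros cf c\<psi>)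
  qed (simp add: supp)
  then show ?thesis
    using i1 i2 unfolding partial_deriv_def by simp
qed

section \<open>A smooth bump function\<close>

text \<open>
  For \<open>t > 0\<close> this is \<open>t\<^sup>-\<^sup>m e\<^sup>-\<^sup>1\<^sup>/\<^sup>t\<close>. The powers make the family closed under differentiation, up to
  linear combinations.
\<close>

definition exp_flat :: "nat \<Rightarrow> real \<Rightarrow> real" where
  "exp_flat m t = (if t \<le> 0 then 0 else inverse t ^ m / exp (inverse t))"

lemma exp_flat_tendsto_0: "(exp_flat m \<longlongrightarrow> 0) (at_right 0)"
proof -
  have "((\<lambda>t. inverse t ^ m / exp (inverse t)) \<longlongrightarrow> (0::real)) (at_right 0)"
    using tendsto_power_div_exp_0 filterlim_inverse_at_top_right by (rule filterlim_compose)
  then show ?thesis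
    by (rule Lim_transform_eventually)
      (auto simp: exp_flat_def eventually_at_right_field intro!: exI[of _ 1])
qed

text \<open>
  At \<open>t = 0\<close> the right difference quotient of the \<open>m\<close>-th function is the \<open>m+1\<close>-st function itself,
  which tends to \<open>0\<close>.
\<close>

lemma exp_flat_has_derivative:
  "(exp_flat m has_real_derivative exp_flat (m + 2) t - real m * exp_flat (m + 1) t) (at t)"
proof (cases t "0::real" rule: linorder_cases)
  case less
  have "((\<lambda>_. 0) has_real_derivative 0) (at t)" by simp
  then have "(exp_flat m has_real_derivative 0) (at t)"
    by (rule has_field_derivative_transform_within_open[where S = "{..<0}"]) (use less in \<open>auto simp: exp_flat_def\<close>)
  then show ?thesis using less by (simp add: exp_flat_def)
next
  case equal
  have "((\<lambda>h. (exp_flat m (0 + h) - exp_flat m 0) / h) \<longlongrightarrow> 0) (at 0)"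
  proof (rule filterlim_split_at)
    have "((\<lambda>h. 0) \<longlongrightarrow> (0::real)) (at_left 0)" by simp
    then show "((\<lambda>h. (exp_flat m (0 + h) - exp_flat m 0) / h) \<longlongrightarrow> 0) (at_left 0)"
      by (rule Lim_transform_eventually)
        (auto simp: exp_flat_def eventually_at_left_field intro!: exI[of _ "-1"])
    show "((\<lambda>h. (exp_flat m (0 + h) - exp_flat m 0) / h) \<longlongrightarrow> 0) (at_right 0)"
      by (rule Lim_transform_eventually[OF exp_flat_tendsto_0[of "Suc m"]])
        (auto simp: exp_flat_def eventually_at_right_field field_simps intro!: exI[of _ 1])
  qed
  then show ?thesis
    using equal by (simp add: has_field_derivative_iff exp_flat_def)
next
  case greater
  have "((\<lambda>t. inverse t ^ m * exp (- inverse t)) has_real_derivative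
      real m * inverse t ^ (m - 1) * (- (inverse t)\<^sup>2) * exp (- inverse t) +
      inverse t ^ m * (exp (- inverse t) * (inverse t)\<^sup>2)) (at t)"
    using greater by (auto intro!: derivative_eq_intros simp: power2_eq_square)
  moreover have "real m * inverse t ^ (m - 1) * (- (inverse t)\<^sup>2) * exp (- inverse t) +
      inverse t ^ m * (exp (- inverse t) * (inverse t)\<^sup>2) = exp_flat (m + 2) t - real m * exp_flat (m + 1) t"
    using greater by (cases m) (auto simp: exp_flat_def exp_minus power2_eq_square divide_inverse algebra_simps)
  ultimately have "((\<lambda>t. inverse t ^ m * exp (- inverse t)) has_real_derivative
      exp_flat (m + 2) t - real m * exp_flat (m + 1) t) (at t)"
    by simp
  then show ?thesis
    by (rule has_field_derivative_transform_within_open[where S = "{0<..}"])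
      (use greater in \<open>auto simp: exp_flat_def exp_minus divide_inverse\<close>)
qed

text \<open>
  The module over the polynomials generated by the functions \<open>exp_flat m (r\<^sup>2 - |x|\<^sup>2)\<close>. It is
  closed under partial derivatives, whence all its members are smooth.
\<close>

inductive flat_span :: "real \<Rightarrow> (real^'n \<Rightarrow> real) \<Rightarrow> bool" for r where
  flat: "flat_span r (\<lambda>x. exp_flat m (r\<^sup>2 - x \<bullet> x))"
| coord: "flat_span r f \<Longrightarrow> flat_span r (\<lambda>x. x $ j * f x)"
| scale: "flat_span r f \<Longrightarrow> flat_span r (\<lambda>x. c * f x)"
| add: "flat_span r f \<Longrightarrow> flat_span r h \<Longrightarrow> flat_span r (\<lambda>x. f x + h x)"

lemma flat_span_partial_deriv:
  assumes "flat_span r f"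
  shows "f differentiable_on UNIV \<and> (\<forall>i. flat_span r (partial_deriv i f))"
  using assms
proof induction
  case (flat m)
  let ?f' = "\<lambda>x::real^'a. exp_flat (m + 2) (r\<^sup>2 - x \<bullet> x) - real m * exp_flat (m + 1) (r\<^sup>2 - x \<bullet> x)"
  have d: "((\<lambda>x::real^'a. exp_flat m (r\<^sup>2 - x \<bullet> x)) has_derivative (\<lambda>h. (- 2 * (x \<bullet> h)) * ?f' x)) (at x)" for x
  proof -
    have "((\<lambda>x::real^'a. r\<^sup>2 - x \<bullet> x) has_derivative (\<lambda>h. - 2 * (x \<bullet> h))) (at x)"
      by (rule has_derivative_eq_rhs, (rule derivative_intros)+) (auto simp: inner_commute)
    from DERIV_compose_FDERIV[OF exp_flat_has_derivative this] show ?thesis .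
  qed
  have "partial_deriv i (\<lambda>x::real^'a. exp_flat m (r\<^sup>2 - x \<bullet> x)) =
      (\<lambda>x. x $ i * ((- 2) * exp_flat (m + 2) (r\<^sup>2 - x \<bullet> x) + (2 * real m) * exp_flat (m + 1) (r\<^sup>2 - x \<bullet> x)))" for i
    by (rule ext) (simp add: partial_deriv_eq[OF d] inner_axis algebra_simps)
  moreover have "flat_span r (\<lambda>x. x $ i *
      ((- 2) * exp_flat (m + 2) (r\<^sup>2 - x \<bullet> x) + (2 * real m) * exp_flat (m + 1) (r\<^sup>2 - x \<bullet> x)))" for i
    by (intro flat_span.intros)
  ultimately have "flat_span r (partial_deriv i (\<lambda>x::real^'a. exp_flat m (r\<^sup>2 - x \<bullet> x)))" for i
    by (simp only:)
  then show ?case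
    by (intro conjI allI differentiable_on_UNIV_I[OF d])
next
  case (coord f j)
  have df: "(f has_derivative frechet_derivative f (at x)) (at x)" for x
    using coord.IH by (simp add: differentiable_on_def frechet_derivative_works)
  have d: "((\<lambda>x. x $ j * f x) has_derivative (\<lambda>h. x $ j * frechet_derivative f (at x) h + h $ j * f x)) (at x)" for x
    by (rule has_derivative_mult[OF _ df])
      (intro bounded_linear_imp_has_derivative bounded_linear_vec_nth)
  have "partial_deriv i (\<lambda>x. x $ j * f x) =
      (\<lambda>x. x $ j * partial_deriv i f x + (if i = j then 1 else 0) * f x)" for i
    by (rule ext) (simp add: partial_deriv_eq[OF d], simp add: partial_deriv_def axis_def)
  moreover have "flat_span r (\<lambda>x. x $ j * partial_deriv i f x + (if i = j then 1 else 0) * f x)" for i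
    using coord by (intro flat_span.intros) auto
  ultimately have "flat_span r (partial_deriv i (\<lambda>x. x $ j * f x))" for i
    by (simp only:)
  then show ?case
    by (intro conjI allI differentiable_on_UNIV_I[OF d])
next
  case (scale f c)
  have df: "(f has_derivative frechet_derivative f (at x)) (at x)" for x
    using scale.IH by (simp add: differentiable_on_def frechet_derivative_works)
  have d: "((\<lambda>x. c * f x) has_derivative (\<lambda>h. c * frechet_derivative f (at x) h)) (at x)" for x
    by (intro has_derivative_mult_right df)
  have "partial_deriv i (\<lambda>x. c * f x) = (\<lambda>x. c * partial_deriv i f x)" for i
    by (rule ext) (simp add: partial_deriv_eq[OF d], simp add: partial_deriv_def)
  moreover have "flat_span r (\<lambda>x. c * partial_deriv i f x)" for i
    using scale by (intro flat_span.intros) auto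
  ultimately have "flat_span r (partial_deriv i (\<lambda>x. c * f x))" for i
    by (simp only:)
  then show ?case
    by (intro conjI allI differentiable_on_UNIV_I[OF d])
next
  case (add f h)
  have df: "(f has_derivative frechet_derivative f (at x)) (at x)" for x
    using add.IH by (simp add: differentiable_on_def frechet_derivative_works)
  have dh: "(h has_derivative frechet_derivative h (at x)) (at x)" for x
    using add.IH by (simp add: differentiable_on_def frechet_derivative_works)
  have d: "((\<lambda>x. f x + h x) has_derivative
      (\<lambda>v. frechet_derivative f (at x) v + frechet_derivative h (at x) v)) (at x)" for x
    by (intro has_derivative_add df dh)
  have "partial_deriv i (\<lambda>x. f x + h x) = (\<lambda>x. partial_deriv i f x + partial_deriv i h x)" for i
    by (rule ext) (simp add: partial_deriv_eq[OF d], simp add: partial_deriv_def)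
  moreover have "flat_span r (\<lambda>x. partial_deriv i f x + partial_deriv i h x)" for i
    using add by (intro flat_span.intros) auto
  ultimately have "flat_span r (partial_deriv i (\<lambda>x. f x + h x))" for i
    by (simp only:)
  then show ?case
    by (intro conjI allI differentiable_on_UNIV_I[OF d])
qed

lemma flat_span_Ck: "flat_span r f \<Longrightarrow> Ck k f"
proof (induction k arbitrary: f)
  case 0
  then show ?case
    using flat_span_partial_deriv[OF 0] by (simp add: differentiable_imp_continuous_on)
next
  case (Suc k)
  then show ?case
    using flat_span_partial_deriv by auto
qed

lemma test_function_bump:
  assumes "0 < r"
  shows "test_function (\<lambda>x::real^'n. exp_flat 0 (r\<^sup>2 - x \<bullet> x))"
    and "\<And>x::real^'n. x \<notin> ball 0 r \<Longrightarrow> exp_flat 0 (r\<^sup>2 - x \<bullet> x) = 0"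
    and "\<And>x::real^'n. 0 \<le> exp_flat 0 (r\<^sup>2 - x \<bullet> x)"
    and "0 < exp_flat 0 (r\<^sup>2 - 0 \<bullet> (0::real^'n))"
proof -
  show off: "exp_flat 0 (r\<^sup>2 - x \<bullet> x) = 0" if "x \<notin> ball 0 r" for x :: "real^'n"
  proof -
    have "r\<^sup>2 \<le> (norm x)\<^sup>2"
      using that assms by (intro power_mono) auto
    then show ?thesis by (simp add: exp_flat_def power2_norm_eq_inner)
  qed
  have "{x::real^'n. exp_flat 0 (r\<^sup>2 - x \<bullet> x) \<noteq> 0} \<subseteq> ball 0 r"
    using off by blast
  then have "bounded {x::real^'n. exp_flat 0 (r\<^sup>2 - x \<bullet> x) \<noteq> 0}"
    by (rule bounded_subset[OF bounded_ball])
  then show "test_function (\<lambda>x::real^'n. exp_flat 0 (r\<^sup>2 - x \<bullet> x))"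
    by (simp add: test_function_def flat_span_Ck[OF flat_span.flat] compact_eq_bounded_closed bounded_closure)
qed (use assms in \<open>auto simp: exp_flat_def\<close>)

section \<open>Distributional Hessians of twice differentiable functions\<close>

text \<open>
  For \<open>\<phi>\<close> with continuously differentiable gradient the weak Hessian acts on test functions as the classical one: integrate
  by parts twice.
\<close>

lemma distr_hessian_entry_integral:
  fixes \<phi> :: "real^'n \<Rightarrow> real"
  assumes \<phi>: "\<And>x. GDERIV \<phi> x :> T x" and T: "\<And>x. (T has_derivative (*v) (J x)) (at x)"
    and J: "continuous_on UNIV J" and H: "has_distr_hessian \<phi> H" and \<psi>: "test_function \<psi>"
  shows "(LINT x|lborel. H x $ i $ j * \<psi> x) = (LINT x|lborel. J x $ i $ j * \<psi> x)"
proof -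
  define K where "K = closure {x. \<psi> x \<noteq> 0}"
  have K: "compact K" using \<psi> by (simp add: test_function_def K_def)
  have supp: "\<psi> x = 0" if "x \<notin> K" for x
    using that closure_subset[of "{x. \<psi> x \<noteq> 0}"] by (auto simp: K_def)
  have "Ck 2 \<psi>" "Ck 1 \<psi>" using \<psi> by (simp_all add: test_function_def del: One_nat_def)
  then have d\<psi>: "\<psi> differentiable_on UNIV" "partial_deriv j \<psi> differentiable_on UNIV"
    and c\<psi>: "continuous_on UNIV (partial_deriv j \<psi>)" "continuous_on UNIV (partial_deriv i (partial_deriv j \<psi>))"
    by (auto simp: numeral_2_eq_2)
  have supp': "partial_deriv j \<psi> x = 0" if "x \<notin> K" for x
  proof -
    have "(\<psi> has_derivative frechet_derivative \<psi> (at x)) (at x)"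
      using d\<psi> by (simp add: differentiable_on_def frechet_derivative_works)
    from has_derivative_zero_off_support[OF this compact_imp_closed[OF K] supp that]
    show ?thesis by (simp add: partial_deriv_def)
  qed
  have cT: "continuous_on UNIV T"
    using T by (meson continuous_at_imp_continuous_on has_derivative_continuous)
  have d\<phi>: "partial_deriv i \<phi> = (\<lambda>x. T x $ i)"
    by (rule ext) (simp add: partial_deriv_eq[OF \<phi>[unfolded gderiv_def]] inner_axis')
  have dTi: "((\<lambda>x. T x $ i) has_derivative (\<lambda>h. (J x *v h) $ i)) (at x)" for x
    using bounded_linear.has_derivative[OF bounded_linear_vec_nth T] .
  have dT: "partial_deriv j (\<lambda>x. T x $ i) = (\<lambda>x. J x $ i $ j)"
    by (rule ext) (simp add: partial_deriv_eq[OF dTi] matrix_vector_mul_component inner_axis)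
  have "(LINT x|lborel. H x $ i $ j * \<psi> x) = (LINT x|lborel. \<phi> x * partial_deriv i (partial_deriv j \<psi>) x)"
    using H \<psi> by (simp add: has_distr_hessian_def)
  also have "\<dots> = - (LINT x|lborel. partial_deriv i \<phi> x * partial_deriv j \<psi> x)"
  proof (rule integral_by_parts_partial_deriv[OF _ _ d\<psi>(2) c\<psi>(2) K supp'])
    show "\<phi> differentiable_on UNIV"
      using \<phi> unfolding gderiv_def by (rule differentiable_on_UNIV_I)
    show "continuous_on UNIV (partial_deriv i \<phi>)"
      unfolding d\<phi> by (intro continuous_intros cT)
  qed
  also have "(LINT x|lborel. partial_deriv i \<phi> x * partial_deriv j \<psi> x) =
      - (LINT x|lborel. partial_deriv j (\<lambda>x. T x $ i) x * \<psi> x)"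
    unfolding d\<phi>
  proof (rule integral_by_parts_partial_deriv[OF _ _ d\<psi>(1) c\<psi>(1) K supp])
    show "(\<lambda>x. T x $ i) differentiable_on UNIV"
      using dTi by (rule differentiable_on_UNIV_I)
    show "continuous_on UNIV (partial_deriv j (\<lambda>x. T x $ i))"
      unfolding dT by (intro continuous_intros J)
  qed
  finally show ?thesis by (simp add: dT)
qed

text \<open>
  An off-diagonal entry is not affected by subtracting the identity and is bounded by the operator norm.
  If the essential norm were below \<open>c\<close>, the entry \<open>H\<^sub>i\<^sub>j\<close> would be below \<open>c\<close> almost everywhere; testing
  against a bump supported where the classical entry is at least \<open>c\<close> gives a contradiction.
\<close>

lemma hessian_minus_id_linf_norm_ge:
  fixes \<phi> :: "real^'n \<Rightarrow> real"
  assumes \<phi>: "\<And>x. GDERIV \<phi> x :> T x" and T: "\<And>x. (T has_derivative (*v) (J x)) (at x)"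
    and J: "continuous_on UNIV J" and "i \<noteq> j" and "0 < r"
    and ge: "\<And>x. x \<in> ball 0 r \<Longrightarrow> c \<le> J x $ i $ j"
  shows "ereal c \<le> hessian_minus_id_linf_norm \<phi>"
  unfolding hessian_minus_id_linf_norm_def
proof (rule INF_greatest, rule ccontr)
  fix H assume "H \<in> Collect (has_distr_hessian \<phi>)"
  then have H: "has_distr_hessian \<phi> H" by simp
  assume less: "\<not> ereal c \<le> linf_norm (\<lambda>x. onorm ((*v) (H x - mat 1)))"
  let ?\<psi> = "\<lambda>x::real^'n. exp_flat 0 (r\<^sup>2 - x \<bullet> x)"
  note bump = test_function_bump[OF \<open>0 < r\<close>]
  have c\<psi>: "continuous_on UNIV ?\<psi>"
    using flat_span_Ck[OF flat_span.flat, of 0] by simp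
  have "AE x in lborel. ereal \<bar>onorm ((*v) (H x - mat 1))\<bar> \<le> linf_norm (\<lambda>x. onorm ((*v) (H x - mat 1)))"
    unfolding linf_norm_def by (rule esssup_AE)
  then have small: "AE x in lborel. H x $ i $ j < c"
  proof eventually_elim
    fix x assume "ereal \<bar>onorm ((*v) (H x - mat 1))\<bar> \<le> linf_norm (\<lambda>x. onorm ((*v) (H x - mat 1)))"
    also have "\<dots> < ereal c"
      using less by (simp only: not_le)
    finally have "\<bar>onorm ((*v) (H x - mat 1))\<bar> < c"
      by simp
    moreover have "\<bar>(H x - mat 1) $ i $ j\<bar> \<le> onorm ((*v) (H x - mat 1))"
      using component_le_onorm[of "(*v) (H x - mat 1)" i j] by simp
    moreover have "(H x - mat 1) $ i $ j = H x $ i $ j"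
      using \<open>i \<noteq> j\<close> by (simp add: mat_def)
    ultimately show "H x $ i $ j < c" by linarith
  qed
  have off: "?\<psi> x = 0" if "x \<notin> cball 0 r" for x
    using that by (intro bump(2)) auto
  have \<psi>_int: "integrable lborel ?\<psi>"
    by (rule integrable_continuous_compact_support[OF c\<psi> compact_cball off])
  have \<psi>J_int: "integrable lborel (\<lambda>x. J x $ i $ j * ?\<psi> x)"
    using off
    by (intro integrable_continuous_compact_support[of _ "cball 0 r"] continuous_intros J c\<psi> compact_cball)
      simp
  have \<psi>_le: "?\<psi> x \<le> 1" for x :: "real^'n"
    by (simp add: exp_flat_def)
  have \<psi>H_int: "integrable lborel (\<lambda>x. H x $ i $ j * ?\<psi> x)"
  proof -
    have "integrable lborel (\<lambda>x. indicator (cball 0 r) x *\<^sub>R H x)"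
      using H by (simp add: has_distr_hessian_def set_integrable_def)
    then have "integrable lborel (\<lambda>x. (indicator (cball 0 r) x *\<^sub>R H x) $ i $ j)"
      by (rule integrable_bounded_linear[rotated])
        (intro bounded_linear_compose[OF bounded_linear_vec_nth] bounded_linear_vec_nth)
    moreover have "(\<lambda>x. H x $ i $ j * ?\<psi> x) \<in> borel_measurable lborel"
    proof -
      have "H \<in> borel_measurable borel" using H by (simp add: has_distr_hessian_def)
      then have "(\<lambda>x. H x $ i $ j) \<in> borel_measurable borel"
        by (rule borel_measurable_continuous_on[rotated]) (intro continuous_intros)
      then show ?thesis using borel_measurable_continuous_onI[OF c\<psi>] by simp
    qed
    ultimately show ?thesis
    proof (rule Bochner_Integration.integrable_bound, intro AE_I2)
      fix x :: "real^'n"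
      show "norm (H x $ i $ j * ?\<psi> x) \<le> norm ((indicator (cball 0 r) x *\<^sub>R H x) $ i $ j)"
        using off[of x] bump(3)[of x] \<psi>_le[of x]
        by (cases "x \<in> cball 0 r") (auto simp: abs_mult mult_left_le)
    qed
  qed
  have "(LINT x|lborel. (c - H x $ i $ j) * ?\<psi> x) = (LINT x|lborel. (c - J x $ i $ j) * ?\<psi> x)"
    using \<psi>_int \<psi>J_int \<psi>H_int distr_hessian_entry_integral[OF \<phi> T J H bump(1), of i j]
    by (simp add: left_diff_distrib)
  also have "\<dots> \<le> 0"
  proof -
    have "(c - J x $ i $ j) * ?\<psi> x \<le> 0" for x
      using ge[of x] bump(2)[of x] bump(3)[of x] by (cases "x \<in> ball 0 r") (auto simp: mult_le_0_iff)
    then have "0 \<le> (LINT x|lborel. - ((c - J x $ i $ j) * ?\<psi> x))"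
      by (intro integral_nonneg_AE AE_I2) simp
    then show ?thesis by simp
  qed
  finally have le0: "(LINT x|lborel. (c - H x $ i $ j) * ?\<psi> x) \<le> 0" .
  have nonneg: "AE x in lborel. 0 \<le> (c - H x $ i $ j) * ?\<psi> x"
    using small by eventually_elim (intro mult_nonneg_nonneg bump(3); simp)
  have "integrable lborel (\<lambda>x. (c - H x $ i $ j) * ?\<psi> x)"
    using \<psi>_int \<psi>H_int by (simp add: left_diff_distrib)
  then have "AE x in lborel. (c - H x $ i $ j) * ?\<psi> x = 0"
    using integral_nonneg_eq_0_iff_AE[OF _ nonneg] le0 integral_nonneg_AE[OF nonneg] by force
  with small have "AE x in lborel. ?\<psi> x = 0"
    by eventually_elim auto
  then have "?\<psi> 0 = 0"
    by (rule closed_AE_lborel_imp_all[OF closed_Collect_eq[OF c\<psi> continuous_on_const]])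
  then show False using bump(4) by simp
qed

section \<open>Measures with density $e^{-V}$ and their push-forwards\<close>

text \<open>
  The density is a product of one-dimensional standard normal densities.
\<close>

lemma prob_space_gauss: "prob_space (exp_measure (gauss_potential :: real^'n \<Rightarrow> real))"
proof
  have density: "exp (- gauss_potential x) = (\<Prod>b\<in>Basis. std_normal_density (x \<bullet> b))" for x :: "real^'n"
  proof -
    have "exp (- (ln (2 * pi) / 2)) = 1 / sqrt (2 * pi)"
    proof -
      have "exp (ln (2 * pi) / 2) = sqrt (2 * pi)"
        by (simp add: ln_sqrt[symmetric])
      then show ?thesis by (simp add: exp_minus inverse_eq_divide)
    qed
    then have "std_normal_density t = exp (- (ln (2 * pi) / 2)) * exp (- t\<^sup>2 / 2)" for t
      by (simp add: std_normal_density_def)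
    then have "std_normal_density t = exp (- (ln (2 * pi) / 2) - t\<^sup>2 / 2)" for t
      by (simp add: exp_add[symmetric])
    then have "(\<Prod>b\<in>Basis. std_normal_density (x \<bullet> b)) =
        exp (\<Sum>b\<in>Basis. - (ln (2 * pi) / 2) - (x \<bullet> b)\<^sup>2 / 2)"
      by (simp add: exp_sum)
    also have "(\<Sum>b\<in>Basis. - (ln (2 * pi) / 2) - (x \<bullet> b)\<^sup>2 / 2) = - gauss_potential x"
    proof -
      have "(norm x)\<^sup>2 = (\<Sum>b\<in>Basis. (x \<bullet> b)\<^sup>2)"
        unfolding power2_norm_eq_inner by (subst euclidean_inner) (simp add: power2_eq_square)
      then show ?thesis
        by (simp add: gauss_potential_def sum_subtractf sum_divide_distrib[symmetric])
    qed
    finally show ?thesis by simp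
  qed
  have "emeasure (exp_measure gauss_potential) (space (exp_measure gauss_potential :: (real^'n) measure)) =
      (\<integral>\<^sup>+ (x::real^'n). ennreal (exp (- gauss_potential x)) \<partial>lborel)"
    unfolding exp_measure_def
    by (subst emeasure_density)
      (auto intro!: borel_measurable_continuous_onI continuous_intros simp: gauss_potential_def)
  also have "\<dots> = (\<integral>\<^sup>+ (x::real^'n). (\<Prod>b\<in>Basis. ennreal (std_normal_density (x \<bullet> b))) \<partial>lborel)"
    by (simp add: density prod_ennreal)
  also have "\<dots> = (\<Prod>b\<in>(Basis :: (real^'n) set). (\<integral>\<^sup>+ t. ennreal (std_normal_density t) \<partial>lborel))"
    by (rule nn_integral_lborel_prod) auto
  also have "(\<integral>\<^sup>+ t. ennreal (std_normal_density t) \<partial>lborel) = 1"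
    using prob_space.emeasure_space_1[OF prob_space_normal_density[of 1 0]]
    by (simp add: emeasure_density)
  finally show "emeasure (exp_measure gauss_potential) (space (exp_measure gauss_potential :: (real^'n) measure)) = 1"
    by simp
qed

text \<open>
  The Jacobian equation \<open>e\<^sup>-\<^sup>V = e\<^sup>-\<^sup>W\<^sup>\<circ>\<^sup>T det (DT)\<close> for the density of the image measure, solved for \<open>W\<close>.
\<close>

lemma distr_exp_measure:
  fixes T :: "real^'n \<Rightarrow> real^'n"
  assumes T: "\<And>x. (T has_derivative (*v) (J x)) (at x)" and "bij T"
    and inv: "continuous_on UNIV (inv T)" and J: "continuous_on UNIV (\<lambda>x. det (J x))"
    and pos: "\<And>x. 0 < det (J x)" and V: "continuous_on UNIV V"
  shows "distr (exp_measure V) borel T = exp_measure (\<lambda>y. V (inv T y) + ln (det (J (inv T y))))"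
proof (rule measure_eqI)
  have "continuous_on UNIV T"
    using T by (meson continuous_at_imp_continuous_on has_derivative_continuous)
  then have [measurable]: "T \<in> borel_measurable borel"
    by (rule borel_measurable_continuous_onI)
  have [measurable]: "V \<in> borel_measurable borel" "inv T \<in> borel_measurable borel"
    "(\<lambda>x. det (J x)) \<in> borel_measurable borel"
    using V inv J by (auto intro: borel_measurable_continuous_onI)
  let ?W = "\<lambda>y. V (inv T y) + ln (det (J (inv T y)))"
  show "sets (distr (exp_measure V) borel T) = sets (exp_measure ?W)"
    by (simp add: exp_measure_def)
  fix A assume "A \<in> sets (distr (exp_measure V) borel T)"
  then have A [measurable]: "A \<in> sets borel" by simp
  let ?f = "\<lambda>y. indicator A y * exp (- ?W y)"
  have "emeasure (exp_measure ?W) A = (\<integral>\<^sup>+ y. ennreal (?f y) \<partial>lborel)"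
    unfolding exp_measure_def
    by (subst emeasure_density) (auto intro!: nn_integral_cong simp: indicator_def)
  also have "\<dots> = (\<integral>\<^sup>+ x. \<bar>det (J x)\<bar> * ?f (T x) \<partial>lborel)"
    by (rule nn_integral_change_of_variables[OF T \<open>bij T\<close>]) auto
  also have "\<dots> = (\<integral>\<^sup>+ x. ennreal (exp (- V x)) * indicator (T -` A) x \<partial>lborel)"
  proof (rule nn_integral_cong)
    fix x
    have "\<bar>det (J x)\<bar> * exp (- ?W (T x)) = exp (- V x)"
      using pos[of x] \<open>bij T\<close> by (simp add: bij_is_inj inv_f_f exp_diff exp_minus field_simps)
    then show "ennreal (\<bar>det (J x)\<bar> * ?f (T x)) = ennreal (exp (- V x)) * indicator (T -` A) x"
      by (auto simp: indicator_def)
  qed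
  also have "\<dots> = emeasure (distr (exp_measure V) borel T) A"
  proof -
    have "T -` A \<in> sets borel"
      using measurable_sets[of T borel borel A] by simp
    moreover have "T \<in> measurable (exp_measure V) borel"
      by (simp add: exp_measure_def)
    ultimately show ?thesis
      by (subst emeasure_distr) (auto simp: exp_measure_def emeasure_density)
  qed
  finally show "emeasure (distr (exp_measure V) borel T) A = emeasure (exp_measure ?W) A"
    by simp
qed

lemma AE_exp_measure_iff:
  assumes "continuous_on UNIV V"
  shows "(AE x in exp_measure V. P x) \<longleftrightarrow> (AE x in lborel. P x)"
proof -
  have "(\<lambda>x. ennreal (exp (- V x))) \<in> borel_measurable lborel"
    using borel_measurable_continuous_onI[OF assms] by simp
  then show ?thesis
    unfolding exp_measure_def by (subst AE_density) auto
qed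

section \<open>Determinants of plane perturbations of the identity\<close>

text \<open>
  In the Leibniz formula only the identity and the transposition of \<open>a\<close> and \<open>b\<close> contribute, since every
  other permutation moves some index whose row is a unit vector.
\<close>

lemma det_identity_off_two_rows:
  fixes A :: "real^'n^'n"
  assumes "a \<noteq> b" and rows: "\<And>i j. i \<noteq> a \<Longrightarrow> i \<noteq> b \<Longrightarrow> A $ i $ j = (if i = j then 1 else 0)"
  shows "det A = A $ a $ a * A $ b $ b - A $ a $ b * A $ b $ a"
proof -
  let ?t = "Transposition.transpose a b"
  let ?term = "\<lambda>p. of_int (sign p) * (\<Prod>i\<in>UNIV. A $ i $ p i)"
  have "?t \<noteq> id"
    using \<open>a \<noteq> b\<close> by (metis id_apply transpose_apply_first)
  have "det A = sum ?term {id, ?t}"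
    unfolding det_def
  proof (rule sum.mono_neutral_right)
    show "\<forall>p\<in>{p. p permutes UNIV} - {id, ?t}. ?term p = 0"
    proof
      fix p assume p: "p \<in> {p. p permutes UNIV} - {id, ?t}"
      have "\<not> p permutes {a, b}"
        using p by (simp add: permutes_doubleton_iff)
      then obtain i where "i \<noteq> a" "i \<noteq> b" "p i \<noteq> i"
        using p by (auto simp: permutes_def)
      then have "A $ i $ p i = 0"
        using rows by auto
      then have "(\<Prod>i\<in>UNIV. A $ i $ p i) = 0"
        by (intro prod_zero) auto
      then show "?term p = 0" by simp
    qed
    show "{id, ?t} \<subseteq> {p. p permutes UNIV}"
      by (auto simp: permutes_swap_id permutes_id intro: permutes_subset)
  qed (simp add: finite_permutations)
  moreover have "(\<Prod>i\<in>UNIV. A $ i $ p i) = A $ a $ p a * A $ b $ p b"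
    if "\<And>i. i \<noteq> a \<Longrightarrow> i \<noteq> b \<Longrightarrow> p i = i" for p
  proof -
    have "(\<Prod>i\<in>UNIV. A $ i $ p i) = (\<Prod>i\<in>{a, b}. A $ i $ p i)"
      using rows that by (intro prod.mono_neutral_right) auto
    then show ?thesis using \<open>a \<noteq> b\<close> by simp
  qed
  ultimately show ?thesis
    using \<open>?t \<noteq> id\<close> \<open>a \<noteq> b\<close> by (simp add: sign_swap_id)
qed

section \<open>A function with bounded Laplacian and large Hessian\<close>

text \<open>
  The function \<open>U X Y = X Y h (X\<^sup>2 + Y\<^sup>2)\<close> with \<open>h s = ln (1 + s) - ln (d + s)\<close>. As \<open>d \<rightarrow> 0\<close> it tends
  to a function that behaves near the origin like \<open>- X Y ln (X\<^sup>2 + Y\<^sup>2)\<close>, whose Laplacian is bounded while its mixed second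
  derivative has a logarithmic singularity. The term \<open>ln (1 + s)\<close> makes \<open>h\<close> decay like \<open>1/s\<close>, which
  keeps \<open>U\<close> and its radial derivative bounded at infinity.
\<close>

locale log_saddle =
  fixes d :: real
  assumes d: "0 < d" "d < 1"
begin

definition h where "h s = ln (1 + s) - ln (d + s)"
text \<open>
  The first two derivatives of the radial profile \<open>h\<close>, then the partial derivatives of \<open>U\<close>. Those with
  the roles of the two variables exchanged are \<open>U1 Y X\<close> and \<open>U11 Y X\<close>, by symmetry.
\<close>

definition h1 where "h1 s = 1 / (1 + s) - 1 / (d + s)"
definition h2 where "h2 s = 1 / (d + s)\<^sup>2 - 1 / (1 + s)\<^sup>2"

text \<open>
  The value of the mixed derivative at the origin, the only quantity below that is unbounded as \<open>d \<rightarrow> 0\<close>.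
\<close>

definition M where "M = - ln d"

definition U where "U X Y = X * Y * h (X\<^sup>2 + Y\<^sup>2)"
definition U1 where "U1 X Y = Y * h (X\<^sup>2 + Y\<^sup>2) + 2 * X\<^sup>2 * Y * h1 (X\<^sup>2 + Y\<^sup>2)"
definition U11 where "U11 X Y = X * Y * (6 * h1 (X\<^sup>2 + Y\<^sup>2) + 4 * X\<^sup>2 * h2 (X\<^sup>2 + Y\<^sup>2))"
definition U12 where "U12 X Y = h (X\<^sup>2 + Y\<^sup>2) + 2 * (X\<^sup>2 + Y\<^sup>2) * h1 (X\<^sup>2 + Y\<^sup>2) + 4 * X\<^sup>2 * Y\<^sup>2 * h2 (X\<^sup>2 + Y\<^sup>2)"

lemma h_deriv: "0 \<le> s \<Longrightarrow> (h has_real_derivative h1 s) (at s)"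
  and h1_deriv: "0 \<le> s \<Longrightarrow> (h1 has_real_derivative h2 s) (at s)"
  unfolding h_def[abs_def] h1_def[abs_def] h2_def using d
  by (auto intro!: derivative_eq_intros simp: power2_eq_square)

lemma h_radial_deriv:
  assumes X: "(X has_derivative X') (at x)" and Y: "(Y has_derivative Y') (at x)"
  shows "((\<lambda>x. h ((X x)\<^sup>2 + (Y x)\<^sup>2)) has_derivative
      (\<lambda>v. (2 * X x * X' v + 2 * Y x * Y' v) * h1 ((X x)\<^sup>2 + (Y x)\<^sup>2))) (at x)"
    and "((\<lambda>x. h1 ((X x)\<^sup>2 + (Y x)\<^sup>2)) has_derivative
      (\<lambda>v. (2 * X x * X' v + 2 * Y x * Y' v) * h2 ((X x)\<^sup>2 + (Y x)\<^sup>2))) (at x)"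
proof -
  have s: "((\<lambda>x. (X x)\<^sup>2 + (Y x)\<^sup>2) has_derivative (\<lambda>v. 2 * X x * X' v + 2 * Y x * Y' v)) (at x)"
    using X Y by (auto intro!: derivative_eq_intros simp: algebra_simps)
  show "((\<lambda>x. h ((X x)\<^sup>2 + (Y x)\<^sup>2)) has_derivative
      (\<lambda>v. (2 * X x * X' v + 2 * Y x * Y' v) * h1 ((X x)\<^sup>2 + (Y x)\<^sup>2))) (at x)"
    by (rule DERIV_compose_FDERIV[OF h_deriv s]) simp
  show "((\<lambda>x. h1 ((X x)\<^sup>2 + (Y x)\<^sup>2)) has_derivative
      (\<lambda>v. (2 * X x * X' v + 2 * Y x * Y' v) * h2 ((X x)\<^sup>2 + (Y x)\<^sup>2))) (at x)"
    by (rule DERIV_compose_FDERIV[OF h1_deriv s]) simp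
qed

lemma U_deriv:
  assumes X: "(X has_derivative X') (at x)" and Y: "(Y has_derivative Y') (at x)"
  shows "((\<lambda>x. U (X x) (Y x)) has_derivative
      (\<lambda>v. U1 (X x) (Y x) * X' v + U1 (Y x) (X x) * Y' v)) (at x)"
  unfolding U_def U1_def
  by (rule has_derivative_eq_rhs,
      (rule has_derivative_mult[OF has_derivative_mult[OF X Y] h_radial_deriv(1)[OF X Y]]))
    (simp add: fun_eq_iff power2_eq_square algebra_simps)

lemma U1_deriv:
  assumes X: "(X has_derivative X') (at x)" and Y: "(Y has_derivative Y') (at x)"
  shows "((\<lambda>x. U1 (X x) (Y x)) has_derivative
      (\<lambda>v. U11 (X x) (Y x) * X' v + U12 (X x) (Y x) * Y' v)) (at x)"
proof -
  have X2: "((\<lambda>x. 2 * (X x)\<^sup>2) has_derivative (\<lambda>v. 4 * X x * X' v)) (at x)"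
    using X by (auto intro!: derivative_eq_intros simp: algebra_simps)
  show ?thesis
    unfolding U1_def U11_def U12_def
    by (rule has_derivative_eq_rhs,
        (rule has_derivative_add[OF has_derivative_mult[OF Y h_radial_deriv(1)[OF X Y]]
          has_derivative_mult[OF has_derivative_mult[OF X2 Y] h_radial_deriv(2)[OF X Y]]]))
      (simp add: fun_eq_iff power2_eq_square algebra_simps)
qed

text \<open>
  Except for the bound by \<open>M\<close> all constants are independent of \<open>d\<close>. The powers of \<open>s\<close> are those by which
  \<open>h\<close> and its derivatives get multiplied in the derivatives of \<open>U\<close>.
\<close>

lemma h_bounds:
  assumes "0 \<le> s"
  shows "0 \<le> h s" "h s \<le> M" "s * h s \<le> 1"
    "s * \<bar>h1 s\<bar> \<le> 1" "s\<^sup>2 * \<bar>h1 s\<bar> \<le> 1" "s\<^sup>2 * \<bar>h2 s\<bar> \<le> 1"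
proof -
  have pos: "0 < d + s" "0 < 1 + s" using d assms by auto
  have h_eq: "h s = ln ((1 + s) / (d + s))"
    using pos by (simp add: h_def ln_div)
  show "0 \<le> h s" using d pos by (simp add: h_def)
  have "s * d \<le> s" using d assms by (simp add: mult_left_le)
  then have "(1 + s) / (d + s) \<le> 1 / d"
    using d pos by (simp add: field_simps)
  then have "h s \<le> ln (1 / d)"
    unfolding h_eq using pos by (intro ln_mono) auto
  then show "h s \<le> M" using d by (simp add: M_def ln_div)
  have "h s \<le> (1 + s) / (d + s) - 1"
    unfolding h_eq using pos by (intro ln_le_minus_one) auto
  also have "\<dots> = (1 - d) / (d + s)"
    using pos by (simp add: field_simps)
  finally have "s * h s \<le> s * ((1 - d) / (d + s))"
    using assms by (rule mult_left_mono)
  also have "\<dots> \<le> 1"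
  proof -
    have "0 \<le> s * d" using d assms by simp
    then have "s * (1 - d) \<le> d + s" using d by (simp add: algebra_simps)
    then show ?thesis using pos by (simp add: divide_simps)
  qed
  finally show "s * h s \<le> 1" .
  have h1_eq: "\<bar>h1 s\<bar> = (1 - d) / ((1 + s) * (d + s))"
  proof -
    have "h1 s = - ((1 - d) / ((1 + s) * (d + s)))"
      using pos by (simp add: h1_def divide_simps)
    then show ?thesis using d pos by (simp add: abs_mult)
  qed
  have sd: "0 \<le> s * d" "0 \<le> s\<^sup>2 * d" using d assms by auto
  have "s * (1 - d) \<le> (1 + s) * (d + s)" "s\<^sup>2 * (1 - d) \<le> (1 + s) * (d + s)"
    using sd d assms by (auto simp: algebra_simps power2_eq_square)
  then show "s * \<bar>h1 s\<bar> \<le> 1" "s\<^sup>2 * \<bar>h1 s\<bar> \<le> 1"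
    unfolding h1_eq using pos by (auto simp: divide_simps)
  have "(d + s)\<^sup>2 \<le> (1 + s)\<^sup>2" using d assms by (intro power_mono) auto
  then have "0 \<le> h2 s"
    unfolding h2_def using pos by (simp add: frac_le)
  moreover have "s\<^sup>2 * h2 s \<le> s\<^sup>2 * (1 / (d + s)\<^sup>2)"
    unfolding h2_def by (intro mult_left_mono) auto
  moreover have "s\<^sup>2 * (1 / (d + s)\<^sup>2) \<le> 1"
  proof -
    have "s\<^sup>2 \<le> (d + s)\<^sup>2" using d assms by (intro power_mono) auto
    then show ?thesis using pos by (simp add: divide_simps)
  qed
  ultimately show "s\<^sup>2 * \<bar>h2 s\<bar> \<le> 1" by simp
qed

lemma product_bounds:
  fixes X Y :: real
  shows "\<bar>X * Y\<bar> \<le> (X\<^sup>2 + Y\<^sup>2) / 2" "4 * X\<^sup>2 * Y\<^sup>2 \<le> (X\<^sup>2 + Y\<^sup>2)\<^sup>2" "\<bar>Y\<bar> \<le> (1 + (X\<^sup>2 + Y\<^sup>2)) / 2"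
proof -
  have "0 \<le> (\<bar>X\<bar> - \<bar>Y\<bar>)\<^sup>2" by simp
  then show "\<bar>X * Y\<bar> \<le> (X\<^sup>2 + Y\<^sup>2) / 2"
    by (simp add: power2_diff abs_mult)
  have "0 \<le> (X\<^sup>2 - Y\<^sup>2)\<^sup>2" by simp
  then show "4 * X\<^sup>2 * Y\<^sup>2 \<le> (X\<^sup>2 + Y\<^sup>2)\<^sup>2"
    by (simp add: power2_diff power2_sum)
  have "0 \<le> (1 - \<bar>Y\<bar>)\<^sup>2" by simp
  then have "2 * \<bar>Y\<bar> \<le> 1 + Y\<^sup>2" by (simp add: power2_diff)
  also have "\<dots> \<le> 1 + (X\<^sup>2 + Y\<^sup>2)" by simp
  finally show "\<bar>Y\<bar> \<le> (1 + (X\<^sup>2 + Y\<^sup>2)) / 2" by simp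
qed

lemma M_nonneg: "0 \<le> M"
  using d by (simp add: M_def)

text \<open>
  The decisive bounds are the last two, on the Laplacian and on the radial derivative: they do not involve
  \<open>M\<close>. In the Laplacian \<open>X Y (12 h' + 4 s h'')\<close> the profile \<open>h\<close> itself does not occur because \<open>X Y\<close> is
  harmonic.
\<close>

lemma U_bounds:
  shows "\<bar>U X Y\<bar> \<le> 1 / 2" and "\<bar>U1 X Y\<bar> \<le> M + 3"
    and "\<bar>U11 X Y\<bar> \<le> 5" and "\<bar>U12 X Y\<bar> \<le> M + 3"
    and "\<bar>U11 X Y + U11 Y X\<bar> \<le> 8" and "\<bar>X * U1 X Y + Y * U1 Y X\<bar> \<le> 2"
proof -
  define s where "s = X\<^sup>2 + Y\<^sup>2"
  have s: "0 \<le> s" "X\<^sup>2 \<le> s" by (auto simp: s_def)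
  note hb = h_bounds[OF s(1)]
  note pb = product_bounds[where X = X and Y = Y, folded s_def]
  have sym: "Y\<^sup>2 + X\<^sup>2 = s" by (simp add: s_def)
  have XYh: "\<bar>X * Y * h s\<bar> \<le> 1 / 2"
    using mult_right_mono[OF pb(1) hb(1)] hb(1,3) by (simp add: abs_mult)
  show "\<bar>U X Y\<bar> \<le> 1 / 2"
    using XYh by (simp add: U_def s_def)
  have XYh1: "\<bar>X * Y * h1 s\<bar> \<le> 1 / 2"
    using mult_right_mono[OF pb(1) abs_ge_zero[of "h1 s"]] hb(4) by (simp add: abs_mult)
  have sXYh1: "\<bar>X * Y * (s * h1 s)\<bar> \<le> 1 / 2"
  proof -
    have "\<bar>X * Y * (s * h1 s)\<bar> = \<bar>X * Y\<bar> * (s * \<bar>h1 s\<bar>)" using s by (simp add: abs_mult)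
    also have "\<dots> \<le> s / 2 * (s * \<bar>h1 s\<bar>)" using s by (intro mult_right_mono pb(1)) auto
    finally show ?thesis using hb(5) by (simp add: power2_eq_square)
  qed
  have sXYh2: "\<bar>X * Y * (s * h2 s)\<bar> \<le> 1 / 2"
  proof -
    have "\<bar>X * Y * (s * h2 s)\<bar> = \<bar>X * Y\<bar> * (s * \<bar>h2 s\<bar>)" using s by (simp add: abs_mult)
    also have "\<dots> \<le> s / 2 * (s * \<bar>h2 s\<bar>)" using s by (intro mult_right_mono pb(1)) auto
    finally show ?thesis using hb(6) by (simp add: power2_eq_square)
  qed
  have X2XYh2: "\<bar>X * Y * (X\<^sup>2 * h2 s)\<bar> \<le> 1 / 2"
  proof -
    have "\<bar>X * Y * (X\<^sup>2 * h2 s)\<bar> = X\<^sup>2 * \<bar>X * Y * h2 s\<bar>" by (simp add: abs_mult)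
    also have "\<dots> \<le> s * \<bar>X * Y * h2 s\<bar>" using s by (intro mult_right_mono) auto
    also have "\<dots> = \<bar>X * Y * (s * h2 s)\<bar>" using s by (simp add: abs_mult)
    finally show ?thesis using sXYh2 by simp
  qed
  have "U11 X Y = 6 * (X * Y * h1 s) + 4 * (X * Y * (X\<^sup>2 * h2 s))"
    by (simp add: U11_def s_def algebra_simps)
  then show "\<bar>U11 X Y\<bar> \<le> 5"
    using XYh1 X2XYh2 by linarith
  have "U11 X Y + U11 Y X = 12 * (X * Y * h1 s) + 4 * (X * Y * (s * h2 s))"
    unfolding U11_def sym s_def[symmetric] by (simp add: s_def algebra_simps)
  then show "\<bar>U11 X Y + U11 Y X\<bar> \<le> 8"
    using XYh1 sXYh2 by linarith
  have "X * U1 X Y + Y * U1 Y X = 2 * (X * Y * h s) + 2 * (X * Y * (s * h1 s))"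
    unfolding U1_def sym s_def[symmetric] by (simp add: s_def power2_eq_square algebra_simps)
  then show "\<bar>X * U1 X Y + Y * U1 Y X\<bar> \<le> 2"
    using XYh sXYh1 by linarith
  have "\<bar>4 * X\<^sup>2 * Y\<^sup>2 * h2 s\<bar> \<le> s\<^sup>2 * \<bar>h2 s\<bar>"
    using mult_right_mono[OF pb(2) abs_ge_zero[of "h2 s"]] by (simp add: abs_mult)
  moreover have "\<bar>2 * s * h1 s\<bar> \<le> 2"
    using hb(4) s by (simp add: abs_mult)
  moreover have "U12 X Y = h s + 2 * s * h1 s + 4 * X\<^sup>2 * Y\<^sup>2 * h2 s"
    by (simp add: U12_def s_def)
  ultimately show "\<bar>U12 X Y\<bar> \<le> M + 3"
    using hb by linarith
  have "\<bar>Y * h s\<bar> \<le> (h s + s * h s) / 2"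
    using mult_right_mono[OF pb(3) hb(1)] hb(1) by (simp add: abs_mult algebra_simps)
  moreover have "\<bar>2 * X\<^sup>2 * Y * h1 s\<bar> \<le> 2"
  proof -
    have "\<bar>2 * X\<^sup>2 * Y * h1 s\<bar> = 2 * (X\<^sup>2 * \<bar>Y\<bar> * \<bar>h1 s\<bar>)" by (simp add: abs_mult)
    also have "\<dots> \<le> 2 * (s * ((1 + s) / 2) * \<bar>h1 s\<bar>)"
      using s pb(3) by (intro mult_left_mono mult_right_mono mult_mono) auto
    also have "\<dots> = s * \<bar>h1 s\<bar> + s\<^sup>2 * \<bar>h1 s\<bar>"
      by (simp add: power2_eq_square algebra_simps)
    finally show ?thesis using hb by linarith
  qed
  moreover have "U1 X Y = Y * h s + 2 * X\<^sup>2 * Y * h1 s"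
    by (simp add: U1_def s_def)
  moreover note M_nonneg
  ultimately show "\<bar>U1 X Y\<bar> \<le> M + 3"
    using hb(2,3) abs_triangle_ineq[of "Y * h s" "2 * X\<^sup>2 * Y * h1 s"] by simp
qed

lemma U12_0: "U12 0 0 = M"
  by (simp add: U12_def h_def M_def)

lemma U12_sym: "U12 X Y = U12 Y X"
  by (simp add: U12_def add.commute mult.commute mult.left_commute)

lemma continuous_second_derivatives:
  fixes X Y :: "'a::topological_space \<Rightarrow> real"
  assumes "continuous_on S X" "continuous_on S Y"
  shows "continuous_on S (\<lambda>x. U11 (X x) (Y x))" "continuous_on S (\<lambda>x. U12 (X x) (Y x))"
proof -
  have pos: "0 < d + ((X x)\<^sup>2 + (Y x)\<^sup>2)" "0 < 1 + ((X x)\<^sup>2 + (Y x)\<^sup>2)" for x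
    using d by (auto intro: add_pos_nonneg)
  then have "d + ((X x)\<^sup>2 + (Y x)\<^sup>2) \<noteq> 0" "1 + ((X x)\<^sup>2 + (Y x)\<^sup>2) \<noteq> 0" for x
    by (metis less_irrefl)+
  then show "continuous_on S (\<lambda>x. U11 (X x) (Y x))" "continuous_on S (\<lambda>x. U12 (X x) (Y x))"
    unfolding U11_def U12_def h_def h1_def h2_def
    by (intro continuous_intros assms ballI; simp)+
qed

end

section \<open>The transport map and its target density\<close>

text \<open>
  The saddle in the coordinates \<open>a\<close> and \<open>b\<close>, scaled by a factor \<open>e\<close> so small that terms of second order
  in \<open>e\<close> are of size \<open>e\<close> even after multiplication by \<open>M\<^sup>2\<close>. The number \<open>8\<close> absorbs the additive
  constants in the bounds of the second derivatives.
\<close>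

locale log_saddle_transport = log_saddle d for d :: real +
  fixes a b :: "'n::finite" and e :: real
  assumes a_neq_b: "a \<noteq> b" and e_pos: "0 < e" and e_small: "40 * e * (M + 8)\<^sup>2 \<le> 1"
begin

definition u :: "real^'n \<Rightarrow> real" where
  "u x = e * U (x $ a) (x $ b)"

definition g :: "real^'n \<Rightarrow> real^'n" where
  "g x = e *\<^sub>R (U1 (x $ a) (x $ b) *\<^sub>R axis a 1 + U1 (x $ b) (x $ a) *\<^sub>R axis b 1)"

definition G :: "real^'n \<Rightarrow> real^'n^'n" where
  "G x = (\<chi> i j. e *
    (if i = a then (if j = a then U11 (x $ a) (x $ b) else 0) + (if j = b then U12 (x $ a) (x $ b) else 0)
     else if i = b then (if j = a then U12 (x $ a) (x $ b) else 0) + (if j = b then U11 (x $ b) (x $ a) else 0)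
     else 0))"

lemma e_consequences:
  "2 * e * (M + 8) < 1 / 2" "e * ((M + 3)\<^sup>2 + 25) \<le> 1 / 4" "e * (M + 3)\<^sup>2 \<le> 1" "8 * e \<le> 1 / 4"
proof -
  have e_M: "40 * (e * (M + 8)\<^sup>2) \<le> 1"
    using e_small by (simp add: algebra_simps)
  have "8 * (M + 8) \<le> (M + 8)\<^sup>2"
    unfolding power2_eq_square using M_nonneg by (intro mult_right_mono) auto
  from mult_left_mono[OF this, of e] e_pos have 1: "8 * (e * (M + 8)) \<le> e * (M + 8)\<^sup>2" by simp
  then show "2 * e * (M + 8) < 1 / 2" using e_M by simp
  have "e * 8 \<le> e * (M + 8)" using e_pos M_nonneg by (intro mult_left_mono) auto
  then show "8 * e \<le> 1 / 4" using 1 e_M by simp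
  have "(M + 3)\<^sup>2 + 25 \<le> (M + 8)\<^sup>2"
    using M_nonneg by (simp add: power2_eq_square algebra_simps)
  from mult_left_mono[OF this less_imp_le[OF e_pos]] e_M
  show 2: "e * ((M + 3)\<^sup>2 + 25) \<le> 1 / 4" by linarith
  have "e * (M + 3)\<^sup>2 \<le> e * ((M + 3)\<^sup>2 + 25)" using e_pos by (intro mult_left_mono) auto
  then show "e * (M + 3)\<^sup>2 \<le> 1" using 2 by simp
qed

lemma coordinate_deriv: "((\<lambda>x::real^'n. x $ i) has_derivative (\<lambda>v. v $ i)) (at x)"
  by (intro bounded_linear_imp_has_derivative bounded_linear_vec_nth)

lemma u_gradient: "GDERIV u x :> g x"
proof -
  have "(u has_derivative (\<lambda>v. e * (U1 (x $ a) (x $ b) * v $ a + U1 (x $ b) (x $ a) * v $ b))) (at x)"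
    unfolding u_def[abs_def]
    by (rule has_derivative_mult_right[OF U_deriv[OF coordinate_deriv coordinate_deriv]])
  moreover have "v \<bullet> g x = e * (U1 (x $ a) (x $ b) * v $ a + U1 (x $ b) (x $ a) * v $ b)" for v
    by (simp add: g_def inner_add_right inner_axis algebra_simps)
  ultimately show ?thesis by (simp add: gderiv_def)
qed

lemma G_mult: "G x *v v = e *\<^sub>R
    ((U11 (x $ a) (x $ b) * v $ a + U12 (x $ a) (x $ b) * v $ b) *\<^sub>R axis a 1 +
     (U11 (x $ b) (x $ a) * v $ b + U12 (x $ b) (x $ a) * v $ a) *\<^sub>R axis b 1)"
proof -
  have delta: "(\<Sum>j\<in>UNIV. e * ((if j = a then p else 0) + (if j = b then q else 0)) * v $ j)
      = e * (p * v $ a + q * v $ b)" for p q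
  proof -
    have "(\<Sum>j\<in>UNIV. e * ((if j = a then p else 0) + (if j = b then q else 0)) * v $ j)
        = (\<Sum>j\<in>UNIV. (if j = a then e * p * v $ a else 0) + (if j = b then e * q * v $ b else 0))"
      by (intro sum.cong) (auto simp: algebra_simps)
    then show ?thesis by (simp add: sum.distrib algebra_simps)
  qed
  have "(G x *v v) $ i = (e *\<^sub>R
    ((U11 (x $ a) (x $ b) * v $ a + U12 (x $ a) (x $ b) * v $ b) *\<^sub>R axis a 1 +
     (U11 (x $ b) (x $ a) * v $ b + U12 (x $ b) (x $ a) * v $ a) *\<^sub>R axis b 1)) $ i" for i
  proof -
    consider "i = a" | "i = b" | "i \<noteq> a" "i \<noteq> b" by blast
    then show ?thesis
    proof cases
      case 1
      then show ?thesis
        using a_neq_b by (simp add: matrix_vector_mult_def G_def delta axis_def)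
    next
      case 2
      then show ?thesis
        using a_neq_b
        by (simp add: matrix_vector_mult_def G_def delta axis_def U12_sym[of "x $ b" "x $ a"] add.commute)
    next
      case 3
      then show ?thesis by (simp add: matrix_vector_mult_def G_def axis_def)
    qed
  qed
  then show ?thesis by (intro vec_eq_iff[THEN iffD2] allI)
qed

lemma g_deriv: "(g has_derivative (*v) (G x)) (at x)"
proof -
  have "(g has_derivative (\<lambda>v. e *\<^sub>R
    ((U11 (x $ a) (x $ b) * v $ a + U12 (x $ a) (x $ b) * v $ b) *\<^sub>R axis a 1 +
     (U11 (x $ b) (x $ a) * v $ b + U12 (x $ b) (x $ a) * v $ a) *\<^sub>R axis b 1))) (at x)"
    unfolding g_def[abs_def]
    by (intro has_derivative_scaleR_right has_derivative_add has_derivative_scaleR_left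
        U1_deriv coordinate_deriv)
  then show ?thesis by (simp only: G_mult[abs_def])
qed

text \<open>
  The components \<open>a\<close> and \<open>b\<close> are the only nonzero ones of \<open>G x *v v\<close>, and each is at most \<open>e (5 + (M + 3)) |v|\<close>.
\<close>

lemma onorm_G: "onorm ((*v) (G x)) \<le> 2 * e * (M + 8)"
proof (rule onorm_bound)
  fix v :: "real^'n"
  have entry: "\<bar>U11 X Y * v $ i + U12 X Y * v $ j\<bar> \<le> (M + 8) * norm v" for X Y i j
  proof -
    have "\<bar>U11 X Y * v $ i + U12 X Y * v $ j\<bar> \<le> \<bar>U11 X Y\<bar> * \<bar>v $ i\<bar> + \<bar>U12 X Y\<bar> * \<bar>v $ j\<bar>"
      by (metis abs_mult abs_triangle_ineq)
    also have "\<dots> \<le> 5 * norm v + (M + 3) * norm v"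
      using M_nonneg U_bounds[of X Y] by (intro add_mono mult_mono component_le_norm_cart) auto
    finally show ?thesis by (simp add: algebra_simps)
  qed
  have "norm (G x *v v) \<le> e *
      (\<bar>U11 (x $ a) (x $ b) * v $ a + U12 (x $ a) (x $ b) * v $ b\<bar> +
       \<bar>U11 (x $ b) (x $ a) * v $ b + U12 (x $ b) (x $ a) * v $ a\<bar>)"
    unfolding G_mult using e_pos
    by (simp add: norm_triangle_le norm_axis_1)
  also have "\<dots> \<le> e * ((M + 8) * norm v + (M + 8) * norm v)"
    using e_pos by (intro mult_left_mono add_mono entry) auto
  finally show "norm (G x *v v) \<le> 2 * e * (M + 8) * norm v"
    by (simp add: algebra_simps)
qed (use e_pos M_nonneg in auto)

lemma norm_g: "(norm (g x))\<^sup>2 \<le> 2 * e * (e * (M + 3)\<^sup>2)"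
proof -
  have "(norm (g x))\<^sup>2 = e\<^sup>2 * ((U1 (x $ a) (x $ b))\<^sup>2 + (U1 (x $ b) (x $ a))\<^sup>2)"
    using a_neq_b unfolding power2_norm_eq_inner
    by (simp add: g_def inner_add inner_axis_axis power2_eq_square algebra_simps)
  also have "\<dots> \<le> e\<^sup>2 * ((M + 3)\<^sup>2 + (M + 3)\<^sup>2)"
  proof -
    have "(U1 X Y)\<^sup>2 \<le> (M + 3)\<^sup>2" for X Y
      using U_bounds(2)[of X Y] M_nonneg by (intro abs_le_square_iff[THEN iffD1]) auto
    then show ?thesis by (intro mult_left_mono add_mono) auto
  qed
  finally show ?thesis by (simp add: power2_eq_square algebra_simps)
qed

sublocale gradient_perturbation u g "2 * e * (M + 8)"
proof
  show "GDERIV u x :> g x" for x by (rule u_gradient)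
  show "norm (g x - g z) \<le> 2 * e * (M + 8) * norm (x - z)" for x z
    by (rule differentiable_bound[of UNIV g "\<lambda>x. (*v) (G x)"]) (auto intro: g_deriv onorm_G)
  show "0 \<le> 2 * e * (M + 8)" using e_pos M_nonneg by simp
  show "2 * e * (M + 8) < 1 / 2" by (rule e_consequences)
  have "\<bar>u x\<bar> \<le> e * (1 / 2)" for x
    unfolding u_def using e_pos U_bounds(1) by (simp add: abs_mult)
  then show "bounded (range u)" by (intro boundedI[of _ "e * (1 / 2)"]) auto
  have "norm (g x) \<le> sqrt (2 * e * (e * (M + 3)\<^sup>2))" for x
    using norm_g by (simp add: real_le_rsqrt)
  then show "bounded (range g)" by (intro boundedI[of _ "sqrt (2 * e * (e * (M + 3)\<^sup>2))"]) auto
qed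

definition J :: "real^'n \<Rightarrow> real^'n^'n" where
  "J x = mat 1 + G x"

lemma transport_deriv: "(transport has_derivative (*v) (J x)) (at x)"
proof -
  have "((\<lambda>x. x + g x) has_derivative (\<lambda>v. v + G x *v v)) (at x)"
    by (intro has_derivative_add has_derivative_ident g_deriv)
  moreover have "(*v) (J x) = (\<lambda>v. v + G x *v v)"
    by (simp add: fun_eq_iff J_def matrix_vector_mult_add_rdistrib)
  ultimately show ?thesis
    by (simp add: transport_def[abs_def])
qed

lemma continuous_J: "continuous_on UNIV J"
proof -
  have "continuous_on UNIV (\<lambda>x. G x $ i $ j)" for i j
    unfolding G_def
    by (cases "i = a"; cases "i = b"; cases "j = a"; cases "j = b")
      (auto intro!: continuous_intros continuous_second_derivatives)
  then have "continuous_on UNIV (\<lambda>x. \<chi> i j. G x $ i $ j)"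
    by (intro continuous_on_vec_lambda)
  then show ?thesis
    unfolding J_def by (intro continuous_intros) simp
qed

lemma det_J_eq: "det (J x) = J x $ a $ a * J x $ b $ b - J x $ a $ b * J x $ b $ a"
  using a_neq_b by (rule det_identity_off_two_rows) (simp add: J_def G_def mat_def)

lemma continuous_det_J: "continuous_on UNIV (\<lambda>x. det (J x))"
  unfolding det_J_eq by (intro continuous_intros continuous_J)

text \<open>
  The term of first order is \<open>e\<close> times the Laplacian of the saddle, hence at most \<open>8 e\<close>; the choice of \<open>e\<close> bounds the quadratic
  term by \<open>e\<close>.
\<close>

lemma det_J: "\<bar>det (J x) - 1\<bar> \<le> 9 * e" "9 * e \<le> 1 / 2"
proof -
  let ?p = "U11 (x $ a) (x $ b)" and ?q = "U12 (x $ a) (x $ b)" and ?r = "U11 (x $ b) (x $ a)"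
  have "det (J x) = 1 + e * (?p + ?r) + e * (e * (?p * ?r - ?q\<^sup>2))"
    unfolding det_J_eq using a_neq_b by (simp add: J_def G_def mat_def power2_eq_square algebra_simps)
  then have det: "det (J x) - 1 = e * (?p + ?r) + e * (e * (?p * ?r - ?q\<^sup>2))" by simp
  have "\<bar>?p * ?r\<bar> \<le> 5 * 5"
    unfolding abs_mult using U_bounds(3) by (intro mult_mono) auto
  moreover have "?q\<^sup>2 \<le> (M + 3)\<^sup>2"
    using U_bounds(4)[of "x $ a" "x $ b"] M_nonneg by (intro abs_le_square_iff[THEN iffD1]) auto
  ultimately have "\<bar>?p * ?r - ?q\<^sup>2\<bar> \<le> (M + 3)\<^sup>2 + 25"
    by (smt (verit) zero_le_power2)
  then have "e * \<bar>?p * ?r - ?q\<^sup>2\<bar> \<le> e * ((M + 3)\<^sup>2 + 25)"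
    using e_pos by (intro mult_left_mono) auto
  also have "\<dots> \<le> 1" using e_consequences(2) by simp
  finally have "\<bar>e * (e * (?p * ?r - ?q\<^sup>2))\<bar> \<le> e * 1"
    using e_pos by (simp add: abs_mult)
  moreover have "\<bar>e * (?p + ?r)\<bar> \<le> e * 8"
    using e_pos U_bounds(5) by (simp add: abs_mult)
  ultimately show "\<bar>det (J x) - 1\<bar> \<le> 9 * e"
    unfolding det by linarith
  show "9 * e \<le> 1 / 2" using e_consequences(4) by simp
qed

lemma det_J_pos: "0 < det (J x)"
  using det_J(1)[of x] det_J(2) by linarith

lemma ln_det_J: "\<bar>ln (det (J x))\<bar> \<le> 18 * e"
proof -
  define t where "t = det (J x) - 1"
  have t_small: "\<bar>t\<bar> \<le> 1 / 2" unfolding t_def using det_J(1)[of x] det_J(2) by linarith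
  then have "\<bar>ln (1 + t) - t\<bar> \<le> 2 * t\<^sup>2"
    by (rule abs_ln_one_plus_x_minus_x_bound)
  also have "2 * t\<^sup>2 \<le> \<bar>t\<bar>"
  proof -
    have "\<bar>t\<bar> * \<bar>t\<bar> \<le> 1 / 2 * \<bar>t\<bar>"
      using t_small by (intro mult_right_mono) auto
    then show ?thesis by (simp add: power2_eq_square)
  qed
  finally have "\<bar>ln (1 + t)\<bar> \<le> 2 * \<bar>t\<bar>" by linarith
  then show ?thesis unfolding t_def using det_J(1)[of x] by simp
qed

text \<open>
  The perturbation of the potential that turns the Gaussian into its image under \<open>transport\<close>.
\<close>

definition pert :: "real^'n \<Rightarrow> real" where
  "pert y = gauss_potential (inv transport y) - gauss_potential y + ln (det (J (inv transport y)))"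

lemma continuous_gauss: "continuous_on S gauss_potential"
  unfolding gauss_potential_def by (intro continuous_intros) auto

lemma continuous_pert: "continuous_on UNIV pert"
proof -
  have "continuous_on UNIV (\<lambda>y. det (J (inv transport y)))"
    by (rule continuous_on_compose2[OF continuous_det_J continuous_inv_transport]) auto
  moreover have "continuous_on UNIV (\<lambda>y. gauss_potential (inv transport y))"
    by (rule continuous_on_compose2[OF continuous_gauss[of UNIV] continuous_inv_transport]) auto
  ultimately show ?thesis
    unfolding pert_def[abs_def] using det_J_pos
    by (intro continuous_intros continuous_gauss) (auto simp: less_imp_neq[symmetric])
qed

text \<open>
  At \<open>y = x + g x\<close> the value is \<open>ln det (J x) - x \<bullet> g x - |g x|\<^sup>2 / 2\<close>, and these three terms are at most
  \<open>18 e\<close>, \<open>2 e\<close> and \<open>e\<close>. To first order this is the Ornstein-Uhlenbeck operator applied to \<open>u\<close>.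
\<close>

lemma pert_bound: "\<bar>pert y\<bar> \<le> 21 * e"
proof -
  define x where "x = inv transport y"
  have y: "y = x + g x" by (simp add: x_def transport_def[symmetric])
  have "(norm y)\<^sup>2 = (norm x)\<^sup>2 + 2 * (x \<bullet> g x) + (norm (g x))\<^sup>2"
    unfolding y power2_norm_eq_inner by (simp add: inner_add inner_commute)
  then have "pert y = ln (det (J x)) - x \<bullet> g x - (norm (g x))\<^sup>2 / 2"
    by (simp add: pert_def x_def[symmetric] gauss_potential_def field_simps)
  moreover have "\<bar>x \<bullet> g x\<bar> \<le> 2 * e"
  proof -
    have "x \<bullet> g x = e * (x $ a * U1 (x $ a) (x $ b) + x $ b * U1 (x $ b) (x $ a))"
      by (simp add: g_def inner_add_right inner_axis algebra_simps)
    then show ?thesis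
      using e_pos U_bounds(6) by (simp add: abs_mult)
  qed
  moreover have "(norm (g x))\<^sup>2 \<le> 2 * e"
  proof -
    have "2 * e * (e * (M + 3)\<^sup>2) \<le> 2 * e * 1"
      using e_pos e_consequences(3) by (intro mult_left_mono) auto
    then show ?thesis using norm_g[of x] by simp
  qed
  ultimately show ?thesis
    using ln_det_J[of x] zero_le_power2[of "norm (g x)"] unfolding abs_le_iff by linarith
qed

lemma distr_gauss_transport:
  "distr (exp_measure gauss_potential) borel transport = exp_measure (\<lambda>x. gauss_potential x + pert x)"
  by (subst distr_exp_measure[OF transport_deriv bij_transport continuous_inv_transport
        continuous_det_J det_J_pos continuous_gauss])
    (simp add: pert_def)

text \<open>
  By uniqueness every admissible map is \<open>transport\<close> almost everywhere, so every admissible potential is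
  differentiable with gradient \<open>transport\<close>, and its Hessian at the origin has the entry \<open>e M\<close>.
\<close>

lemma optimal_potential_hessian:
  fixes \<phi> :: "real^'n \<Rightarrow> real"
  assumes S: "optimal_transport (exp_measure gauss_potential) (distr (exp_measure gauss_potential) borel transport) S"
    and \<phi>: "convex_potential (exp_measure gauss_potential) S \<phi>"
    and c: "c < e * M"
  shows "ereal c \<le> hessian_minus_id_linf_norm \<phi>"
proof -
  have "AE x in exp_measure gauss_potential. S x = transport x"
    by (rule optimal_transport_unique[OF prob_space_gauss _ S]) (simp add: exp_measure_def)
  moreover have "AE x in exp_measure gauss_potential. GDERIV \<phi> x :> S x"
    using \<phi> by (simp add: convex_potential_def)
  ultimately have "AE x in exp_measure gauss_potential. GDERIV \<phi> x :> transport x"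
    by eventually_elim simp
  then have "AE x in lborel. GDERIV \<phi> x :> transport x"
    by (simp add: AE_exp_measure_iff[OF continuous_gauss])
  then have grad: "GDERIV \<phi> x :> transport x" for x
    using \<phi> by (intro convex_gradient_everywhere continuous_transport) (auto simp: convex_potential_def)
  have "J 0 $ a $ b = e * M"
    using a_neq_b by (simp add: J_def G_def mat_def U12_0)
  then have "0 \<in> {x. c < J x $ a $ b}" using c by simp
  moreover have "open {x. c < J x $ a $ b}"
    by (intro open_Collect_less continuous_intros continuous_J)
  ultimately obtain r where "0 < r" "ball 0 r \<subseteq> {x. c < J x $ a $ b}"
    by (meson openE)
  then show ?thesis
    by (intro hessian_minus_id_linf_norm_ge[OF grad transport_deriv continuous_J a_neq_b]) auto
qed

end

section \<open>Failure of the linear bound\<close>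

theorem proposition6p1:
  assumes "CARD('n::finite) \<ge> 2"
  shows "\<forall>C>0. \<exists>p :: real ^ 'n \<Rightarrow> real.
    bounded (range p) \<and> continuous_on UNIV p \<and> linf_norm p \<le> 1 \<and>
    prob_space (exp_measure (\<lambda>x. gauss_potential x + p x)) \<and>
    (let \<mu> = exp_measure gauss_potential;
         \<nu> = exp_measure (\<lambda>x. gauss_potential x + p x)
     in (\<exists>T \<phi>. optimal_transport \<mu> \<nu> T \<and> convex_potential \<mu> T \<phi>) \<and>
        (\<forall>T \<phi>. optimal_transport \<mu> \<nu> T \<and> convex_potential \<mu> T \<phi> \<longrightarrow>
           hessian_minus_id_linf_norm \<phi> > ereal C * linf_norm p))"
proof (intro allI impI)
  fix C :: real assume "C > 0"
  obtain a b :: 'n where "a \<noteq> b"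
  proof -
    have "\<not> card (UNIV :: 'n set) \<le> Suc 0" using assms by simp
    then have "\<exists>a b :: 'n. a \<noteq> b" by (simp add: card_le_Suc0_iff_eq)
    then show thesis using that by blast
  qed
  \<comment> \<open>The perturbation has norm at most 21 e and the Hessian norm is at least e K / 2, so K has to exceed 42 C.\<close>
  define K where "K = 42 * C + 1"
  \<comment> \<open>With this d the mixed derivative of the saddle at the origin is K.\<close>
  define d where "d = exp (- K)"
  define e where "e = 1 / (40 * (8 + K)\<^sup>2)"
  have "0 < K" using \<open>C > 0\<close> by (simp add: K_def)
  then have "40 * e * (8 + K)\<^sup>2 = 1" and "0 < e"
    by (simp_all add: e_def)
  have "0 < d" "d < 1" and M_eq: "log_saddle.M d = K"
    using \<open>0 < K\<close> by (auto simp: d_def log_saddle.M_def log_saddle_def)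
  interpret log_saddle_transport d a b e
    using \<open>a \<noteq> b\<close> \<open>0 < d\<close> \<open>d < 1\<close> \<open>0 < e\<close> \<open>40 * e * (8 + K)\<^sup>2 = 1\<close>
    by unfold_locales (simp_all add: M_eq add.commute)
  let ?\<mu> = "exp_measure gauss_potential :: (real^'n) measure"
  let ?\<nu> = "exp_measure (\<lambda>x. gauss_potential x + pert x)"
  have sets: "sets ?\<mu> = sets borel" by (simp add: exp_measure_def)
  have linf: "linf_norm pert \<le> ereal (21 * e)"
  proof -
    have "(\<lambda>x. ereal \<bar>pert x\<bar>) \<in> borel_measurable lborel"
      using borel_measurable_continuous_onI[OF continuous_pert] by simp
    then show ?thesis
      unfolding linf_norm_def using pert_bound by (intro esssup_I) auto
  qed
  have "21 * e \<le> 1"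
  proof -
    have "1 * 1 \<le> (8 + K)\<^sup>2"
      unfolding power2_eq_square using \<open>0 < K\<close> by (intro mult_mono) auto
    then have "e \<le> 1 / (40 * 1)"
      unfolding e_def by (intro frac_le) auto
    then show ?thesis by simp
  qed
  then have "ereal (21 * e) \<le> 1" by simp
  then have norm: "linf_norm pert \<le> 1"
    by (rule order_trans[OF linf])
  have bdd: "bounded (range pert)"
    using pert_bound by (intro boundedI[of _ "21 * e"]) auto
  have prob: "prob_space ?\<nu>"
    unfolding distr_gauss_transport[symmetric]
    by (intro prob_space.prob_space_distr prob_space_gauss) (simp add: exp_measure_def)
  have opt: "optimal_transport ?\<mu> ?\<nu> transport"
    unfolding distr_gauss_transport[symmetric]
    by (rule optimal_transport_transport[OF prob_space_gauss sets])
  have large: "ereal C * linf_norm pert < hessian_minus_id_linf_norm \<phi>"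
    if "optimal_transport ?\<mu> ?\<nu> T" "convex_potential ?\<mu> T \<phi>" for T \<phi>
  proof -
    have "ereal C * linf_norm pert \<le> ereal C * ereal (21 * e)"
      using linf \<open>C > 0\<close> by (intro ereal_mult_left_mono) auto
    also have "\<dots> < ereal (e * K / 2)"
      using \<open>0 < e\<close> by (simp add: K_def)
    also have "\<dots> \<le> hessian_minus_id_linf_norm \<phi>"
    proof (rule optimal_potential_hessian)
      show "optimal_transport ?\<mu> (distr ?\<mu> borel transport) T"
        using that(1) by (simp add: distr_gauss_transport)
      show "e * K / 2 < e * log_saddle.M d"
        using \<open>0 < e\<close> \<open>0 < K\<close> by (simp add: M_eq)
    qed (rule that)
    finally show ?thesis .
  qed
  show "\<exists>p :: real ^ 'n \<Rightarrow> real.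
    bounded (range p) \<and> continuous_on UNIV p \<and> linf_norm p \<le> 1 \<and>
    prob_space (exp_measure (\<lambda>x. gauss_potential x + p x)) \<and>
    (let \<mu> = exp_measure gauss_potential;
         \<nu> = exp_measure (\<lambda>x. gauss_potential x + p x)
     in (\<exists>T \<phi>. optimal_transport \<mu> \<nu> T \<and> convex_potential \<mu> T \<phi>) \<and>
        (\<forall>T \<phi>. optimal_transport \<mu> \<nu> T \<and> convex_potential \<mu> T \<phi> \<longrightarrow>
           hessian_minus_id_linf_norm \<phi> > ereal C * linf_norm p))"
    unfolding Let_def
  proof (intro exI[of _ pert] conjI allI impI)
    show "\<exists>T \<phi>. optimal_transport ?\<mu> ?\<nu> T \<and> convex_potential ?\<mu> T \<phi>"
      using opt convex_potential_transport by (intro exI conjI)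
  qed (use bdd continuous_pert norm prob large in auto)
qed

end
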